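(* There is a universal constant $c>0$ such that for all integers $d\ge1$, $L\ge2$ and $1\le k\le \tfrac12 L^d$, the spectral gap of the exclusion process on $G=\mathbf{Z}^d/L\mathbf{Z}^d$ with $k$ black balls is at least $$\frac{c}{(\log d)\,L^2},$$ where $\log d$ is read as $1$ when $d=1$. Equivalently, the relaxation time (inverse spectral gap) is $O(L^2\log d)$ with a universal implied constant.
   Context: Exclusion process on a finite connected graph $G=(V,E)$ with $k\le |V|/2$ black balls: a configuration places one ball at each vertex, $k$ of the balls being black and the remaining $|V|-k$ white, with balls of the same color indistinguishable. It is the continuous-time Markov process in which, independently for each edge $e$ at rate 1, the balls at the two endpoints of $e$ are switched. It is reversible with respect to the uniform distribution; its spectral gap is the smallest nonzero eigenvalue of minus its generator. $\mathbf{Z}^d/L\mathbf{Z}^d$ denotes the $d$-dimensional discrete torus with nearest-neighbor edges and $L^d$ vertices (for $L=2$ it is the hypercube $\{0,1\}^d$ with simple edges). *)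

theory Defs
  imports Complex_Main "HOL-Library.FuncSet"
begin

(* A configuration is encoded by the set of vertices carrying a black ball; edges are
   two-element vertex sets. *)
definition configs :: "'v set \<Rightarrow> nat \<Rightarrow> 'v set set" where
  "configs V k = {A. A \<subseteq> V \<and> card A = k}"

definition edge_swap :: "'v set \<Rightarrow> 'v \<Rightarrow> 'v" where
  "edge_swap e v = (if v \<in> e then the_elem (e - {v}) else v)"

definition switch :: "'v set \<Rightarrow> 'v set \<Rightarrow> 'v set" where
  "switch e A = edge_swap e ` A"

definition exclusion_generator :: "'v set set \<Rightarrow> ('v set \<Rightarrow> real) \<Rightarrow> 'v set \<Rightarrow> real" where
  "exclusion_generator E f A = (\<Sum>e\<in>E. f (switch e A) - f A)"

(* Functions on configurations are total functions whose values off configs V k are irrelevant: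
   switching preserves configs V k. The generator is symmetric there, so real eigenvalues suffice. *)
definition exclusion_eigenvalue :: "'v set \<Rightarrow> 'v set set \<Rightarrow> nat \<Rightarrow> real \<Rightarrow> bool" where
  "exclusion_eigenvalue V E k \<mu> \<longleftrightarrow>
     (\<exists>f. (\<exists>A\<in>configs V k. f A \<noteq> 0) \<and>
          (\<forall>A\<in>configs V k. - exclusion_generator E f A = \<mu> * f A))"

definition spectral_gap :: "'v set \<Rightarrow> 'v set set \<Rightarrow> nat \<Rightarrow> real" where
  "spectral_gap V E k = Min {\<mu>. exclusion_eigenvalue V E k \<mu> \<and> \<mu> \<noteq> 0}"

definition relaxation_time :: "'v set \<Rightarrow> 'v set set \<Rightarrow> nat \<Rightarrow> real" where
  "relaxation_time V E k = 1 / spectral_gap V E k"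

(* Z^d / L Z^d by coordinatewise representatives in {0,...,L-1}, for L >= 2. *)
definition torus_verts :: "nat \<Rightarrow> nat \<Rightarrow> (nat \<Rightarrow> nat) set" where
  "torus_verts d L = {..<d} \<rightarrow>\<^sub>E {..<L}"

(* Edges form a set, so for L = 2 the steps +1 and -1 in a coordinate give one simple edge. *)
definition torus_edges :: "nat \<Rightarrow> nat \<Rightarrow> (nat \<Rightarrow> nat) set set" where
  "torus_edges d L =
     {{x, x(i := (x i + 1) mod L)} | x i. x \<in> torus_verts d L \<and> i < d}"

definition log_dim :: "nat \<Rightarrow> real" where
  "log_dim d = (if d = 1 then 1 else ln (real d))"

end

theory Submission
  imports Defs "HOL-Combinatorics.Transposition" "HOL-Analysis.Convex" "HOL-Analysis.Function_Topology"
begin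

text \<open>
  By the method of Caputo, Liggett and Richthammer, the exclusion process on a weighted graph has at
  least the spectral gap of the random walk on that graph. Functions of the form
  \<open>\<Sum>x\<in>A. g x\<close> form an invariant subspace on which the exclusion generator acts like the random
  walk. A function \<open>h\<close> orthogonal to them has mean zero even when the content of one vertex \<open>z\<close> is
  fixed, so one can induct on the number of vertices: eliminate \<open>z\<close> as in electrical network reduction
  (weights \<open>w x y + w z x * w z y / (\<Sum>x. w z x)\<close>), which does not decrease the random walk gap, and
  by the octopus inequality does not increase the Dirichlet form.

  On the torus the random walk gap is at least of order \<open>1 / L\<^sup>2\<close> by tensorising a Poincare
  inequality on paths. This even removes the logarithm of the dimension.
\<close>

section \<open>The octopus inequality\<close>

text \<open>The obstacle is that nonnegativity of \<open>T\<close> cannot be read off its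
  coefficients. For a single ball on \<open>z\<close>, \<open>i\<close>, \<open>j\<close>, with
  \<open>f x\<close> its value at site \<open>x\<close>, the form of \<open>legs z i j\<close> is
  \<open>2 * (f z - f i) * (f z - f j)\<close>, which is indefinite for \<open>i \<noteq> j\<close>.
  The whole single-ball form, however, is
  \<open>2 * ((\<Sum>i. c i) * f z - (\<Sum>i. c i * f i))^2\<close>, twice the square of one linear
  functional whose coefficient vector has squared length \<open>q\<close>. Hence
  \<open>T^2 = 2 * q * T\<close> holds exactly there, which is where the factor \<open>2 * q\<close>
  comes from. For several balls there is a defect \<open>2 * q * T - T^2\<close>; it has degree four
  in the weights, and now each symmetrised coefficient is nonnegative by itself. Such a coefficient
  moves only the contents of \<open>z\<close> and at most four other sites, and \<open>f\<close>
  sees only which sites are black, so finitely many polynomial identities settle all weights and all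
  graphs.\<close>

text \<open>
  Here \<open>z\<close> is the body of the octopus. With \<open>P x y\<close> denoting composition with a transposition,
  \<open>legs z i j\<close> is \<open>1 + P i j - P z i - P z j\<close>, the coefficient of \<open>c i * c j\<close> in
  \<open>T = \<Sum>i j. c i * c j * P i j\<close> when the sum includes \<open>z\<close> with weight \<open>- (\<Sum>i. c i)\<close>.
  With \<open>q\<close> the sum of all squared weights, \<open>leg_form z i j k l\<close> is the symmetrised coefficient
  of \<open>c i * c j * c k * c l\<close> in \<open>2 * q * T - T\<^sup>2\<close>; the summands \<open>of_bool\<close> come from the squares in \<open>q\<close>.
\<close>
definition legs :: "'v \<Rightarrow> 'v \<Rightarrow> 'v \<Rightarrow> ('v set \<Rightarrow> real) \<Rightarrow> 'v set \<Rightarrow> real" where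
  "legs z i j f A = f A + f (transpose i j ` A) - f (transpose z i ` A) - f (transpose z j ` A)"

definition leg_pair :: "'v \<Rightarrow> 'v \<Rightarrow> 'v \<Rightarrow> 'v \<Rightarrow> 'v \<Rightarrow> ('v set \<Rightarrow> real) \<Rightarrow> 'v set \<Rightarrow> real" where
  "leg_pair z i j k l f A =
     (1 + of_bool (k = l)) * (f A * legs z i j f A) + (1 + of_bool (i = j)) * (f A * legs z k l f A)
     - legs z i j f A * legs z k l f A"

definition leg_form :: "'v \<Rightarrow> 'v \<Rightarrow> 'v \<Rightarrow> 'v \<Rightarrow> 'v \<Rightarrow> ('v set \<Rightarrow> real) \<Rightarrow> 'v set \<Rightarrow> real" where
  "leg_form z i j k l f A = leg_pair z i j k l f A + leg_pair z i k j l f A + leg_pair z i l j k f A"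

section \<open>Local quadratic forms on at most five sites\<close>

lemma sum_Pow_insert:
  assumes "finite W" "p \<notin> W"
  shows "(\<Sum>A\<in>Pow (insert p W). f A) = (\<Sum>A\<in>Pow W. f A + f (insert p A))"
proof -
  have "(\<Sum>A\<in>Pow (insert p W). f A) = (\<Sum>A\<in>Pow W. f A) + (\<Sum>A\<in>insert p ` Pow W. f A)"
    unfolding Pow_insert using assms by (intro sum.union_disjoint) auto
  moreover have "inj_on (insert p) (Pow W)" using assms by (auto simp: inj_on_def)
  ultimately show ?thesis by (simp add: sum.reindex sum.distrib)
qed

lemma transpose_image_id: "x \<notin> A \<Longrightarrow> y \<notin> A \<Longrightarrow> transpose x y ` A = A"
  by (metis image_cong image_ident transpose_apply_other)

text \<open>Freezes the contents outside \<open>S\<close>. A form that moves only the contents of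
  \<open>S\<close> becomes, for each frozen \<open>A\<close>, a polynomial in the
  \<open>2 ^ card S\<close> values of \<open>f\<close>, which can be expanded and checked.\<close>

lemma sum_Pow_split:
  assumes "finite V" "S \<subseteq> V"
  shows "(\<Sum>A\<in>Pow V. f A) = (\<Sum>A\<in>Pow (V - S). \<Sum>B\<in>Pow S. f (B \<union> A))"
proof -
  have "finite (V - S)" using assms by simp
  then have "(\<Sum>A\<in>Pow ((V - S) \<union> S). f A) = (\<Sum>A\<in>Pow (V - S). \<Sum>B\<in>Pow S. f (B \<union> A))"
    unfolding sum.cartesian_product
    by (intro sum.reindex_bij_witness[where i = "\<lambda>(A,B). B \<union> A" and j = "\<lambda>A. (A - S, A \<inter> S)"])
       (auto simp: Int_Diff_Un)
  moreover have "(V - S) \<union> S = V" using assms by auto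
  ultimately show ?thesis by simp
qed

text \<open>The suffix of the next five names is the coincidence pattern of the four legs.\<close>

lemma sum_leg_form_1111:
  assumes "finite V" "{z,i} \<subseteq> V" "distinct [z,i]"
  shows "(\<Sum>A\<in>Pow V. leg_form z i i i i f A) = 0"
proof -
  have ne: "z \<noteq> i" "i \<noteq> z"
    using assms(3) by auto
  have *: "(\<Sum>S\<in>Pow {z,i}. leg_form z i i i i f (S \<union> A)) = 0"
    if A: "z \<notin> A" "i \<notin> A" for A
      by (simp add: sum_Pow_insert ne)
        (simp add: leg_form_def leg_pair_def legs_def transpose_image_id insert_commute ne A, algebra)
  show ?thesis
    unfolding sum_Pow_split[OF assms(1,2)] by (rule sum.neutral) (use * in auto)
qed

lemma sum_leg_form_1112:
  assumes "finite V" "{z,i,l} \<subseteq> V" "distinct [z,i,l]"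
  shows "(\<Sum>A\<in>Pow V. leg_form z i i i l f A) = 0"
proof -
  have ne: "z \<noteq> i" "z \<noteq> l" "i \<noteq> z" "i \<noteq> l" "l \<noteq> z" "l \<noteq> i"
    using assms(3) by auto
  have *: "(\<Sum>S\<in>Pow {z,i,l}. leg_form z i i i l f (S \<union> A)) = 0"
    if A: "z \<notin> A" "i \<notin> A" "l \<notin> A" for A
      by (simp add: sum_Pow_insert ne)
        (simp add: leg_form_def leg_pair_def legs_def transpose_image_id insert_commute ne A, algebra)
  show ?thesis
    unfolding sum_Pow_split[OF assms(1,2)] by (rule sum.neutral) (use * in auto)
qed

lemma sum_leg_form_1122:
  assumes "finite V" "{z,i,l} \<subseteq> V" "distinct [z,i,l]"
  shows "(\<Sum>A\<in>Pow V. leg_form z i i l l f A) = 0"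
proof -
  have ne: "z \<noteq> i" "z \<noteq> l" "i \<noteq> z" "i \<noteq> l" "l \<noteq> z" "l \<noteq> i"
    using assms(3) by auto
  have *: "(\<Sum>S\<in>Pow {z,i,l}. leg_form z i i l l f (S \<union> A)) = 0"
    if A: "z \<notin> A" "i \<notin> A" "l \<notin> A" for A
      by (simp add: sum_Pow_insert ne)
        (simp add: leg_form_def leg_pair_def legs_def transpose_image_id insert_commute ne A, algebra)
  show ?thesis
    unfolding sum_Pow_split[OF assms(1,2)] by (rule sum.neutral) (use * in auto)
qed

text \<open>Only configurations with two black balls on the four sites contribute. Each of the three
  splittings of \<open>{z,i,k,l}\<close> into complementary pairs gets the sum of \<open>f\<close>
  over its two pairs, and the squares compare these three sums.\<close>

lemma sum_leg_form_1123:
  assumes "finite V" "{z,i,k,l} \<subseteq> V" "distinct [z,i,k,l]"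
  shows "(\<Sum>A\<in>Pow V. leg_form z i i k l f A) \<ge> 0"
proof -
  have ne: "z \<noteq> i" "z \<noteq> k" "z \<noteq> l" "i \<noteq> z" "i \<noteq> k" "i \<noteq> l" "k \<noteq> z" "k \<noteq> i" "k \<noteq> l" "l \<noteq> z" "l \<noteq> i" "l \<noteq> k"
    using assms(3) by auto
  have *: "(\<Sum>S\<in>Pow {z,i,k,l}. leg_form z i i k l f (S \<union> A)) \<ge> 0"
    if A: "z \<notin> A" "i \<notin> A" "k \<notin> A" "l \<notin> A" for A
  proof -
    have "(\<Sum>S\<in>Pow {z,i,k,l}. leg_form z i i k l f (S \<union> A)) = 2 * ((f (insert z (insert i A))
        + f (insert k (insert l A)) - (f (insert z (insert k A)) + f (insert i (insert l A))))^2
        + (f (insert z (insert i A)) + f (insert k (insert l A)) - (f (insert z (insert l A)) + f (insert i (insert k A))))^2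
        + (f (insert z (insert k A)) + f (insert i (insert l A)) - (f (insert z (insert l A)) + f (insert i (insert k A))))^2)"
      by (simp add: sum_Pow_insert ne)
        (simp add: leg_form_def leg_pair_def legs_def transpose_image_id insert_commute ne A, algebra)
    also have "\<dots> \<ge> 0"
      by (intro mult_nonneg_nonneg add_nonneg_nonneg zero_le_power2) simp_all
    finally show ?thesis .
  qed
  show ?thesis
    unfolding sum_Pow_split[OF assms(1,2)] by (rule sum_nonneg) (use * in auto)
qed

text \<open>
  On five sites the form is twelve times a projection onto a three-dimensional space in each of the
  sectors with two and three black balls, which gives the sum of squares below.
\<close>
lemma sum_leg_form_1234:
  assumes "finite V" "{z,i,j,k,l} \<subseteq> V" "distinct [z,i,j,k,l]"
  shows "(\<Sum>A\<in>Pow V. leg_form z i j k l f A) \<ge> 0"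
proof -
  have ne: "z \<noteq> i" "z \<noteq> j" "z \<noteq> k" "z \<noteq> l" "i \<noteq> z" "i \<noteq> j" "i \<noteq> k" "i \<noteq> l" "j \<noteq> z" "j \<noteq> i" "j \<noteq> k" "j \<noteq> l" "k \<noteq> z" "k \<noteq> i" "k \<noteq> j" "k \<noteq> l" "l \<noteq> z" "l \<noteq> i" "l \<noteq> j" "l \<noteq> k"
    using assms(3) by auto
  have *: "(\<Sum>S\<in>Pow {z,i,j,k,l}. leg_form z i j k l f (S \<union> A)) \<ge> 0"
    if A: "z \<notin> A" "i \<notin> A" "j \<notin> A" "k \<notin> A" "l \<notin> A" for A
  proof -
    \<comment> \<open>The first square has coefficient 3 at the pair \<open>{z,i}\<close>, -1 at
      pairs sharing one site with it and 1 at disjoint pairs, a vector orthogonal to all linear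
      functions. The next three squares do the same for \<open>j\<close>, \<open>k\<close>,
      \<open>l\<close>; the last four arise by complementing the sets.\<close>
    have "(\<Sum>S\<in>Pow {z,i,j,k,l}. leg_form z i j k l f (S \<union> A)) = 1/2 *
        ((3 * f (insert z (insert i A)) - f (insert z (insert j A)) - f (insert z (insert k A))
            - f (insert z (insert l A)) - f (insert i (insert j A)) - f (insert i (insert k A)) - f (insert i (insert l A))
            + f (insert j (insert k A)) + f (insert j (insert l A)) + f (insert k (insert l A)))^2
         + (-f (insert z (insert i A)) + 3 * f (insert z (insert j A)) - f (insert z (insert k A))
             - f (insert z (insert l A)) - f (insert i (insert j A)) + f (insert i (insert k A)) + f (insert i (insert l A))
             - f (insert j (insert k A)) - f (insert j (insert l A)) + f (insert k (insert l A)))^2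
         + (-f (insert z (insert i A)) - f (insert z (insert j A)) + 3 * f (insert z (insert k A))
             - f (insert z (insert l A)) + f (insert i (insert j A)) - f (insert i (insert k A)) + f (insert i (insert l A))
             - f (insert j (insert k A)) + f (insert j (insert l A)) - f (insert k (insert l A)))^2
         + (-f (insert z (insert i A)) - f (insert z (insert j A)) - f (insert z (insert k A))
             + 3 * f (insert z (insert l A)) + f (insert i (insert j A)) + f (insert i (insert k A))
             - f (insert i (insert l A)) + f (insert j (insert k A)) - f (insert j (insert l A))
             - f (insert k (insert l A)))^2
         + (3 * f (insert j (insert k (insert l A))) - f (insert i (insert k (insert l A)))
             - f (insert i (insert j (insert l A))) - f (insert i (insert j (insert k A)))
             - f (insert z (insert k (insert l A))) - f (insert z (insert j (insert l A)))
             - f (insert z (insert j (insert k A))) + f (insert z (insert i (insert l A)))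
             + f (insert z (insert i (insert k A))) + f (insert z (insert i (insert j A))))^2
         + (-f (insert j (insert k (insert l A))) + 3 * f (insert i (insert k (insert l A)))
             - f (insert i (insert j (insert l A))) - f (insert i (insert j (insert k A)))
             - f (insert z (insert k (insert l A))) + f (insert z (insert j (insert l A)))
             + f (insert z (insert j (insert k A))) - f (insert z (insert i (insert l A)))
             - f (insert z (insert i (insert k A))) + f (insert z (insert i (insert j A))))^2
         + (-f (insert j (insert k (insert l A))) - f (insert i (insert k (insert l A)))
             + 3 * f (insert i (insert j (insert l A))) - f (insert i (insert j (insert k A)))
             + f (insert z (insert k (insert l A))) - f (insert z (insert j (insert l A)))
             + f (insert z (insert j (insert k A))) - f (insert z (insert i (insert l A)))
             + f (insert z (insert i (insert k A))) - f (insert z (insert i (insert j A))))^2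
         + (-f (insert j (insert k (insert l A))) - f (insert i (insert k (insert l A)))
             - f (insert i (insert j (insert l A))) + 3 * f (insert i (insert j (insert k A)))
             + f (insert z (insert k (insert l A))) + f (insert z (insert j (insert l A)))
             - f (insert z (insert j (insert k A))) + f (insert z (insert i (insert l A)))
             - f (insert z (insert i (insert k A))) - f (insert z (insert i (insert j A))))^2)"
      by (simp add: sum_Pow_insert ne)
        (simp add: leg_form_def leg_pair_def legs_def transpose_image_id insert_commute ne A, algebra)
    also have "\<dots> \<ge> 0"
      by (intro mult_nonneg_nonneg add_nonneg_nonneg zero_le_power2) simp_all
    finally show ?thesis .
  qed
  show ?thesis
    unfolding sum_Pow_split[OF assms(1,2)] by (rule sum_nonneg) (use * in auto)
qed

lemma legs_commute: "legs z j i f A = legs z i j f A"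
  by (simp add: legs_def transpose_commute)

lemma leg_pair_sym:
  "leg_pair z j i k l f A = leg_pair z i j k l f A"
  "leg_pair z i j l k f A = leg_pair z i j k l f A"
  "leg_pair z k l i j f A = leg_pair z i j k l f A"
  by (simp_all add: leg_pair_def legs_commute[of z j i] legs_commute[of z l k] eq_commute[of l k] eq_commute[of j i])

text \<open>The three summands of \<open>leg_form\<close> are the three pairings of four legs, and
  an adjacent transposition permutes them up to \<open>leg_pair_sym\<close>. So only the coincidence
  pattern of the legs matters.\<close>

lemma leg_form_swap:
  "leg_form z j i k l f A = leg_form z i j k l f A"
  "leg_form z i k j l f A = leg_form z i j k l f A"
  "leg_form z i j l k f A = leg_form z i j k l f A"
  unfolding leg_form_def
  using leg_pair_sym[of z _ _ _ _ f A]
  by (smt (verit))+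

text \<open>By the symmetry, two equal legs can be moved to the front, which leaves the five
  patterns above.\<close>

lemma sum_leg_form_nonneg:
  assumes V: "finite V" "z \<in> V" and mem: "i \<in> V - {z}" "j \<in> V - {z}" "k \<in> V - {z}" "l \<in> V - {z}"
  shows "(\<Sum>A\<in>Pow V. leg_form z i j k l f A) \<ge> 0"
proof -
  define S where "S i j k l = (\<Sum>A\<in>Pow V. leg_form z i j k l f A)" for i j k l
  have S12: "S j i k l = S i j k l" and S23: "S i k j l = S i j k l" and S34: "S i j l k = S i j k l"
    for i j k l
    by (simp_all add: S_def leg_form_swap(1)[of z j i] leg_form_swap(2)[of z i k j] leg_form_swap(3)[of z i j l k])
  have eq: "S i i k l \<ge> 0" if m: "i \<in> V - {z}" "k \<in> V - {z}" "l \<in> V - {z}" for i k l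
  proof -
    have 3: "S i i i l \<ge> 0" if "i \<in> V - {z}" "l \<in> V - {z}" for i l
      using sum_leg_form_1111[OF V(1), of z i] sum_leg_form_1112[OF V(1), of z i l] V(2) that
      unfolding S_def by (cases "i = l") auto
    consider "i = k" | "i = l" | "i \<noteq> k" "i \<noteq> l" "k = l" | "i \<noteq> k" "i \<noteq> l" "k \<noteq> l" by blast
    then show ?thesis
    proof cases
      case 1 then show ?thesis using 3 m by simp
    next
      case 2 then show ?thesis using 3[of i k] m S34[of i i i k] by simp
    next
      case 3 then show ?thesis using sum_leg_form_1122[OF V(1), of z i l] V(2) m unfolding S_def by auto
    next
      case 4 then show ?thesis using sum_leg_form_1123[OF V(1), of z i k l] V(2) m unfolding S_def by auto
    qed
  qed
  show ?thesis
  proof (cases "distinct [i,j,k,l]")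
    case True
    then show ?thesis using sum_leg_form_1234[OF V(1), of z i j k l] V(2) mem by auto
  next
    case False
    then consider "i = j" | "i = k" | "i = l" | "j = k" | "j = l" | "k = l" by auto
    then have "S i j k l \<ge> 0"
    proof cases
      case 1 then show ?thesis using eq mem by simp
    next
      case 2 then show ?thesis using eq[of i j l] S23[of i i j l] mem by simp
    next
      case 3 then show ?thesis using eq[of i j k] S23[of i i j k] S34[of i j i k] mem by simp
    next
      case 4 then show ?thesis using eq[of j i l] S12[of i j j l] S23[of j j i l] mem by simp
    next
      case 5 then show ?thesis
        using eq[of j i k] S12[of i j k j] S34[of j i j k] S23[of j j i k] mem by simp
    next
      case 6 then show ?thesis
        using eq[of k i j] S23[of k k i j] S12[of i k k j] S34[of i k j k] S23[of i j k k] mem by simp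
    qed
    then show ?thesis by (simp add: S_def)
  qed
qed

definition swap_energy :: "'v set \<Rightarrow> ('v set \<Rightarrow> real) \<Rightarrow> 'v \<Rightarrow> 'v \<Rightarrow> real" where
  "swap_energy V f x y = (\<Sum>A\<in>Pow V. f A * (f A - f (transpose x y ` A)))"

text \<open>The array \<open>b\<close> writes \<open>q\<close> as a double sum over the legs: its
  constant part gives the square of the weight of the body, its diagonal part the squares of the
  weights of the legs.\<close>

lemma sum_leg_pair:
  fixes c :: "'v \<Rightarrow> real" and f :: "'v set \<Rightarrow> real" and z :: 'v
  assumes "finite U"
  defines "T \<equiv> \<lambda>A. \<Sum>i\<in>U. \<Sum>j\<in>U. c i * c j * legs z i j f A"
  shows "(\<Sum>i\<in>U. \<Sum>j\<in>U. \<Sum>k\<in>U. \<Sum>l\<in>U. c i * c j * c k * c l * leg_pair z i j k l f A)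
       = 2 * ((\<Sum>i\<in>U. c i)^2 + (\<Sum>i\<in>U. (c i)^2)) * (f A * T A) - (T A)^2"
proof -
  define a where "a i j = c i * c j * legs z i j f A" for i j
  define b where "b i j = c i * c j * (1 + of_bool (i = j))" for i j
  have "c i * c j * c k * c l * leg_pair z i j k l f A =
     f A * (a i j * b k l) + f A * (b i j * a k l) - a i j * a k l" for i j k l
    by (simp add: a_def b_def leg_pair_def algebra_simps)
  then have "(\<Sum>i\<in>U. \<Sum>j\<in>U. \<Sum>k\<in>U. \<Sum>l\<in>U. c i * c j * c k * c l * leg_pair z i j k l f A)
     = f A * ((\<Sum>i\<in>U. \<Sum>j\<in>U. a i j) * (\<Sum>k\<in>U. \<Sum>l\<in>U. b k l))
     + f A * ((\<Sum>i\<in>U. \<Sum>j\<in>U. b i j) * (\<Sum>k\<in>U. \<Sum>l\<in>U. a k l))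
     - (\<Sum>i\<in>U. \<Sum>j\<in>U. a i j) * (\<Sum>k\<in>U. \<Sum>l\<in>U. a k l)"
    by (simp add: sum.distrib sum_subtractf flip: sum_distrib_left sum_distrib_right)
  moreover have "(\<Sum>i\<in>U. \<Sum>j\<in>U. b i j) = (\<Sum>i\<in>U. c i)^2 + (\<Sum>i\<in>U. (c i)^2)"
  proof -
    have "(\<Sum>j\<in>U. c i * c j * of_bool (i = j)) = (c i)^2" if "i \<in> U" for i
      using assms(1) that by (simp add: of_bool_def if_distrib[of "(*) _"] sum.delta' power2_eq_square cong: if_cong)
    then show ?thesis
      by (simp add: b_def distrib_left sum.distrib power2_eq_square sum_product)
  qed
  moreover have "(\<Sum>i\<in>U. \<Sum>j\<in>U. a i j) = T A" by (simp add: a_def T_def)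
  ultimately show ?thesis by (simp add: algebra_simps power2_eq_square)
qed

text \<open>Nonnegativity of all coefficients means \<open>T\<^sup>2 \<le> 2 * q * T\<close> as quadratic forms, whence \<open>T \<ge> 0\<close>.\<close>
lemma octopus_inequality:
  fixes c :: "'v \<Rightarrow> real"
  assumes V: "finite V" "z \<in> V" and c: "\<And>i. i \<in> V - {z} \<Longrightarrow> c i \<ge> 0"
  defines "U \<equiv> V - {z}"
  shows "(\<Sum>i\<in>U. \<Sum>j\<in>U. c i * c j * swap_energy V f i j)
       \<le> 2 * (\<Sum>i\<in>U. c i) * (\<Sum>i\<in>U. c i * swap_energy V f z i)"
proof -
  have U: "finite U" using V by (simp add: U_def)
  define T where "T A = (\<Sum>i\<in>U. \<Sum>j\<in>U. c i * c j * legs z i j f A)" for A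
  define q where "q = (\<Sum>i\<in>U. c i)^2 + (\<Sum>i\<in>U. (c i)^2)"
  define X where "X = (\<Sum>A\<in>Pow V. f A * T A)"
  define P where "P i j k l A = c i * c j * c k * c l * leg_pair z i j k l f A" for i j k l A
  have P: "(\<Sum>i\<in>U. \<Sum>j\<in>U. \<Sum>k\<in>U. \<Sum>l\<in>U. P i j k l A) = 2 * q * (f A * T A) - (T A)^2" for A
    unfolding P_def T_def q_def by (rule sum_leg_pair[OF U])
  \<comment> \<open>Pairing the four indices differently only renames summation variables, so each
    summand of \<open>leg_form\<close> contributes the same total; this gives the factor 3
    below.\<close>
  have P2: "(\<Sum>i\<in>U. \<Sum>j\<in>U. \<Sum>k\<in>U. \<Sum>l\<in>U. P i k j l A) = 2 * q * (f A * T A) - (T A)^2" for A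
    unfolding P[symmetric] by (rule sum.cong[OF refl]) (rule sum.swap)
  have P3: "(\<Sum>i\<in>U. \<Sum>j\<in>U. \<Sum>k\<in>U. \<Sum>l\<in>U. P i l j k A) = 2 * q * (f A * T A) - (T A)^2" for A
    unfolding P[symmetric]
  proof (rule sum.cong[OF refl])
    fix i
    have "(\<Sum>j\<in>U. \<Sum>k\<in>U. \<Sum>l\<in>U. P i l j k A) = (\<Sum>j\<in>U. \<Sum>l\<in>U. \<Sum>k\<in>U. P i l j k A)"
      by (rule sum.cong[OF refl]) (rule sum.swap)
    also have "\<dots> = (\<Sum>l\<in>U. \<Sum>j\<in>U. \<Sum>k\<in>U. P i l j k A)" by (rule sum.swap)
    finally show "(\<Sum>j\<in>U. \<Sum>k\<in>U. \<Sum>l\<in>U. P i l j k A) = (\<Sum>l\<in>U. \<Sum>j\<in>U. \<Sum>k\<in>U. P i l j k A)" .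
  qed
  have "0 \<le> (\<Sum>i\<in>U. \<Sum>j\<in>U. \<Sum>k\<in>U. \<Sum>l\<in>U. c i * c j * c k * c l * (\<Sum>A\<in>Pow V. leg_form z i j k l f A))"
    by ((rule sum_nonneg)+, intro mult_nonneg_nonneg sum_leg_form_nonneg)
       (use c V in \<open>auto simp: U_def\<close>)
  also have "\<dots> = (\<Sum>A\<in>Pow V. \<Sum>i\<in>U. \<Sum>j\<in>U. \<Sum>k\<in>U. \<Sum>l\<in>U. c i * c j * c k * c l * leg_form z i j k l f A)"
    by (simp only: sum_distrib_left sum.swap[of _ "Pow V" U])
  also have "\<dots> = (\<Sum>A\<in>Pow V. \<Sum>i\<in>U. \<Sum>j\<in>U. \<Sum>k\<in>U. \<Sum>l\<in>U. P i j k l A + P i k j l A + P i l j k A)"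
    by (simp add: P_def leg_form_def algebra_simps)
  also have "\<dots> = (\<Sum>A\<in>Pow V. 3 * (2 * q * (f A * T A) - (T A)^2))"
    by (simp only: sum.distrib P P2 P3 flip: sum_distrib_left)
  also have "\<dots> = 3 * (2 * q * X - (\<Sum>A\<in>Pow V. (T A)^2))"
    by (simp add: X_def sum_distrib_left sum_subtractf algebra_simps)
  finally have main: "(\<Sum>A\<in>Pow V. (T A)^2) \<le> 2 * q * X"
    by (simp add: algebra_simps)
  have "X \<ge> 0"
  proof (cases "q = 0")
    case True
    then have "(\<Sum>A\<in>Pow V. (T A)^2) = 0" using main by (simp add: sum_nonneg antisym)
    then have "\<forall>A\<in>Pow V. T A = 0" using V(1) by (simp add: sum_nonneg_eq_0_iff)
    then show ?thesis by (simp add: X_def)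
  next
    case False
    then have "q > 0" unfolding q_def by (smt (verit) sum_nonneg zero_le_power2)
    moreover have "0 \<le> 2 * q * X" using main by (smt (verit) sum_nonneg zero_le_power2)
    ultimately show ?thesis by (simp add: zero_le_mult_iff)
  qed
  have "X = (\<Sum>A\<in>Pow V. \<Sum>i\<in>U. \<Sum>j\<in>U. c i * c j * (f A * legs z i j f A))"
    by (simp add: X_def T_def sum_distrib_left algebra_simps)
  also have "\<dots> = (\<Sum>i\<in>U. \<Sum>j\<in>U. c i * c j * (\<Sum>A\<in>Pow V. f A * legs z i j f A))"
    by (simp only: sum_distrib_left sum.swap[of _ "Pow V" U])
  also have "\<dots> = (\<Sum>i\<in>U. \<Sum>j\<in>U. c i * c j * (swap_energy V f z i + swap_energy V f z j - swap_energy V f i j))"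
    by (simp add: swap_energy_def legs_def algebra_simps flip: sum.distrib sum_subtractf)
  also have "\<dots> = 2 * (\<Sum>i\<in>U. c i) * (\<Sum>i\<in>U. c i * swap_energy V f z i)
      - (\<Sum>i\<in>U. \<Sum>j\<in>U. c i * c j * swap_energy V f i j)"
  proof -
    have "(\<Sum>i\<in>U. \<Sum>j\<in>U. c i * c j * swap_energy V f z i) = (\<Sum>i\<in>U. c i) * (\<Sum>i\<in>U. c i * swap_energy V f z i)"
      unfolding sum_product by (subst sum.swap) (simp add: algebra_simps)
    moreover have "(\<Sum>i\<in>U. \<Sum>j\<in>U. c i * c j * swap_energy V f z j) = (\<Sum>i\<in>U. c i) * (\<Sum>i\<in>U. c i * swap_energy V f z i)"
      unfolding sum_product by (simp add: algebra_simps)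
    ultimately show ?thesis
      by (simp add: ring_distribs sum.distrib sum_subtractf)
  qed
  finally show ?thesis using \<open>X \<ge> 0\<close> by simp
qed

section \<open>Linear functions of the configuration\<close>

lemma finite_configs: "finite V \<Longrightarrow> finite (configs V k)"
  by (auto simp: configs_def intro: finite_subset[of _ "Pow V"])

lemma transpose_image_eq:
  assumes "x \<noteq> y"
  shows "transpose x y ` A = (if x \<in> A \<longleftrightarrow> y \<in> A then A else if x \<in> A then insert y (A - {x}) else insert x (A - {y}))"
  using assms by (auto simp: transpose_def image_iff)

lemma transpose_image_subset_iff:
  assumes "x \<in> V" "y \<in> V"
  shows "transpose x y ` A \<subseteq> V \<longleftrightarrow> A \<subseteq> V"
proof -
  have "transpose x y ` A \<subseteq> V" if "A \<subseteq> V" for A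
    using that assms by (auto simp: transpose_def)
  from this[of A] this[of "transpose x y ` A"] show ?thesis by (auto simp: image_comp)
qed

lemma card_transpose_image: "card (transpose x y ` A) = card A"
  by (simp add: card_image)

lemma sum_Pow_transpose:
  assumes "x \<in> V" "y \<in> V"
  shows "(\<Sum>A\<in>Pow V. f (transpose x y ` A)) = (\<Sum>A\<in>Pow V. f A)"
  by (rule sum.reindex_bij_witness[where i = "(`) (transpose x y)" and j = "(`) (transpose x y)"])
     (use assms in \<open>auto simp: transpose_image_subset_iff image_comp\<close>)

lemma sum_Pow_configs:
  assumes "finite V"
  shows "(\<Sum>A\<in>Pow V. f A) = (\<Sum>k\<le>card V. \<Sum>A\<in>configs V k. f A)"
proof -
  have "(\<Sum>k\<in>{..card V}. \<Sum>A\<in>{A\<in>Pow V. card A = k}. f A) = (\<Sum>A\<in>Pow V. f A)"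
    using assms by (intro sum.group) (auto intro: card_mono)
  then show ?thesis by (simp add: configs_def)
qed

lemma card_configs_with:
  assumes "finite V" "x \<in> V" "k \<ge> 1"
  shows "card {A \<in> configs V k. x \<in> A} = (card V - 1) choose (k - 1)"
proof -
  have "bij_betw (insert x) {B. B \<subseteq> V - {x} \<and> card B = k - 1} {A \<in> configs V k. x \<in> A}"
    by (rule bij_betw_byWitness[where f' = "\<lambda>A. A - {x}"])
       (use assms in \<open>auto simp: configs_def card_insert_if finite_subset\<close>)
  then have "card {A \<in> configs V k. x \<in> A} = card {B. B \<subseteq> V - {x} \<and> card B = k - 1}"
    by (rule bij_betw_same_card[symmetric])
  also have "\<dots> = card (V - {x}) choose (k - 1)" using assms(1) by (intro n_subsets) simp
  finally show ?thesis using assms by simp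
qed

lemma card_configs_with_without:
  assumes "finite V" "x \<in> V" "y \<in> V" "x \<noteq> y" "k \<ge> 1"
  shows "card {A \<in> configs V k. x \<in> A \<and> y \<notin> A} = (card V - 2) choose (k - 1)"
proof -
  have "{A \<in> configs V k. x \<in> A \<and> y \<notin> A} = {A \<in> configs (V - {y}) k. x \<in> A}"
    by (auto simp: configs_def)
  then show ?thesis using card_configs_with[of "V - {y}" x k] assms
    by (simp add: numeral_2_eq_2)
qed

text \<open>All configurations counted contain \<open>x\<close>, while any other \<open>y\<close> is
  missed by the same number \<open>m\<close> of them. As \<open>g\<close> sums to zero, only the
  deficit \<open>- m\<close> at each \<open>y \<noteq> x\<close> counts, and it sums to
  \<open>m * g x\<close>.\<close>

lemma sum_linear_with:
  fixes g :: "'v \<Rightarrow> real"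
  assumes "finite V" "x \<in> V" "k \<ge> 1" "(\<Sum>y\<in>V. g y) = 0"
  shows "(\<Sum>A\<in>{A \<in> configs V k. x \<in> A}. \<Sum>y\<in>A. g y) = real ((card V - 2) choose (k - 1)) * g x"
proof -
  define C where "C = {A \<in> configs V k. x \<in> A}"
  define m where "m = real ((card V - 2) choose (k - 1))"
  have C: "finite C" by (simp add: C_def finite_configs[OF assms(1)])
  have "(\<Sum>A\<in>C. of_bool (y \<in> A)) = real (card C) - (if y = x then 0 else m)" if "y \<in> V" for y
  proof (cases "y = x")
    case True then show ?thesis by (simp add: C_def)
  next
    case False
    have "{A \<in> C. y \<notin> A} = {A \<in> configs V k. x \<in> A \<and> y \<notin> A}" by (auto simp: C_def)
    then have "(\<Sum>A\<in>C. of_bool (y \<notin> A)) = m"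
      using card_configs_with_without[OF assms(1,2) that False[symmetric] assms(3)] C
      by (simp add: m_def of_bool_def flip: sum.inter_filter)
    moreover have "(\<Sum>A\<in>C. of_bool (y \<in> A)) = real (card C) - (\<Sum>A\<in>C. of_bool (y \<notin> A))"
      by (simp add: of_bool_not_iff sum_subtractf)
    ultimately show ?thesis using False by simp
  qed
  then have eq: "(\<Sum>y\<in>V. g y * (\<Sum>A\<in>C. of_bool (y \<in> A))) = (\<Sum>y\<in>V. g y * (real (card C) - (if y = x then 0 else m)))"
    by simp
  have "(\<Sum>A\<in>C. \<Sum>y\<in>A. g y) = (\<Sum>A\<in>C. \<Sum>y\<in>V. g y * of_bool (y \<in> A))"
    using assms(1) by (intro sum.cong refl sum.mono_neutral_cong_left) (auto simp: C_def configs_def)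
  also have "\<dots> = (\<Sum>y\<in>V. g y * (\<Sum>A\<in>C. of_bool (y \<in> A)))"
    by (subst sum.swap) (simp add: sum_distrib_left)
  also have "\<dots> = (\<Sum>y\<in>V. g y * (real (card C) - m) + (if y = x then m * g y else 0))"
    unfolding eq by (intro sum.cong refl) (simp add: algebra_simps)
  also have "\<dots> = m * g x"
    using assms by (simp add: sum.distrib flip: sum_distrib_right)
  finally show ?thesis by (simp add: C_def m_def)
qed

text \<open>Pairing with a linear function sees \<open>h\<close> only through its sums over the
  configurations containing a given site. Vanishing of these sums is therefore orthogonality to all
  linear functions.\<close>

lemma sum_linear_mult:
  fixes h :: "'v set \<Rightarrow> real"
  assumes "finite V"
  shows "(\<Sum>A\<in>configs V k. h A * (\<Sum>x\<in>A. b x)) = (\<Sum>x\<in>V. b x * (\<Sum>A\<in>{A \<in> configs V k. x \<in> A}. h A))"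
proof -
  have "(\<Sum>A\<in>configs V k. h A * (\<Sum>x\<in>A. b x)) = (\<Sum>A\<in>configs V k. \<Sum>x\<in>V. b x * (if x \<in> A then h A else 0))"
    unfolding sum_distrib_left
    using assms(1) by (intro sum.cong refl sum.mono_neutral_cong_left) (auto simp: configs_def)
  also have "\<dots> = (\<Sum>x\<in>V. b x * (\<Sum>A\<in>{A \<in> configs V k. x \<in> A}. h A))"
    using assms by (subst sum.swap) (simp add: sum.inter_filter finite_configs flip: sum_distrib_left)
  finally show ?thesis .
qed

text \<open>The orthogonal projection onto linear functions within one level. The conditional sums
  \<open>F\<close> again sum to zero, since each configuration is counted \<open>k\<close> times, so
  \<open>sum_linear_with\<close> is inverted by dividing by \<open>m\<close>.\<close>

lemma linear_projection:
  fixes f :: "'v set \<Rightarrow> real"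
  assumes V: "finite V" and f: "(\<Sum>A\<in>configs V k. f A) = 0"
  obtains g :: "'v \<Rightarrow> real" where "(\<Sum>x\<in>V. g x) = 0"
    "\<And>x. x \<in> V \<Longrightarrow> (\<Sum>A\<in>{A \<in> configs V k. x \<in> A}. f A - (\<Sum>y\<in>A. g y)) = 0"
proof -
  define F where "F x = (\<Sum>A\<in>{A \<in> configs V k. x \<in> A}. f A)" for x
  define m where "m = real ((card V - 2) choose (k - 1))"
  have "(\<Sum>x\<in>V. F x) = (\<Sum>A\<in>configs V k. f A * (\<Sum>x\<in>A. 1))"
    using sum_linear_mult[OF V, of f "\<lambda>_. 1" k] by (simp add: F_def)
  also have "\<dots> = (\<Sum>A\<in>configs V k. f A) * real k"
    unfolding sum_distrib_right by (intro sum.cong) (auto simp: configs_def)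
  finally have F: "(\<Sum>x\<in>V. F x) = 0" using f by simp
  show ?thesis
  proof (cases "k = 0 \<or> m = 0")
    case True
    \<comment> \<open>The degenerate levels: no configuration contains \<open>x\<close>, or
      \<open>k \<ge> card V\<close> and every configuration does. Either way \<open>g = 0\<close>
      works.\<close>
    have "F x = 0" if x: "x \<in> V" for x
    proof (cases "k = 0")
      case True
      have "{A \<in> configs V k. x \<in> A} = {}"
        using V True by (auto simp: configs_def finite_subset)
      then show ?thesis unfolding F_def by (simp only: sum.empty)
    next
      case False
      then have "card V - 2 < k - 1" using True by (auto simp: m_def)
      then have "card V \<le> k" by simp
      then have "{A \<in> configs V k. x \<in> A} = configs V k"
        using card_seteq[OF V] x by (auto simp: configs_def)
      then show ?thesis using f by (simp add: F_def)
    qed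
    then show ?thesis using that[of "\<lambda>_. 0"] by (simp add: F_def)
  next
    case False
    define g where "g x = F x / m" for x
    have g: "(\<Sum>x\<in>V. g x) = 0" using F by (simp add: g_def flip: sum_divide_distrib)
    show ?thesis
    proof (rule that[OF g])
      fix x assume "x \<in> V"
      from sum_linear_with[OF V this _ g, of k] False
      have "(\<Sum>A\<in>{A \<in> configs V k. x \<in> A}. \<Sum>y\<in>A. g y) = m * g x" by (simp add: m_def)
      also have "\<dots> = F x" using False by (simp add: g_def)
      finally show "(\<Sum>A\<in>{A \<in> configs V k. x \<in> A}. f A - (\<Sum>y\<in>A. g y)) = 0"
        by (simp add: sum_subtractf F_def)
    qed
  qed
qed

text \<open>Up to one binomial factor, linear functions on a level carry the inner product of
  functions on \<open>V\<close>. Later \<open>b\<close> will be the walk Laplacian of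
  \<open>g\<close>.\<close>

lemma sum_linear_linear:
  fixes g :: "'v \<Rightarrow> real"
  assumes "finite V" "(\<Sum>y\<in>V. g y) = 0" "k \<ge> 1"
  shows "(\<Sum>A\<in>configs V k. (\<Sum>x\<in>A. g x) * (\<Sum>x\<in>A. b x)) = real ((card V - 2) choose (k - 1)) * (\<Sum>x\<in>V. g x * b x)"
  unfolding sum_linear_mult[OF assms(1)] sum_distrib_left[of _ _ V]
  by (intro sum.cong refl) (simp add: sum_linear_with[OF assms(1) _ assms(3,2)])

text \<open>Weights are real since eliminating a vertex leaves the 0-1 weights of a graph. It may
  also create diagonal weights, which multiply zero here.\<close>

definition laplacian :: "'v set \<Rightarrow> ('v \<Rightarrow> 'v \<Rightarrow> real) \<Rightarrow> ('v set \<Rightarrow> real) \<Rightarrow> 'v set \<Rightarrow> real" where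
  "laplacian V w f A = (\<Sum>x\<in>V. \<Sum>y\<in>V. w x y * (f A - f (transpose x y ` A)))"

lemma sum_mult_laplacian:
  "(\<Sum>A\<in>Pow V. f A * laplacian V w g A)
     = (\<Sum>x\<in>V. \<Sum>y\<in>V. w x y * (\<Sum>A\<in>Pow V. f A * (g A - g (transpose x y ` A))))"
  by (simp add: laplacian_def sum_distrib_left sum.swap[of _ "Pow V" V] mult.left_commute)

lemma laplacian_symmetric:
  assumes "finite V"
  shows "(\<Sum>A\<in>Pow V. f A * laplacian V w g A) = (\<Sum>A\<in>Pow V. g A * laplacian V w f A)"
proof -
  have *: "(\<Sum>A\<in>Pow V. f A * (g A - g (transpose x y ` A))) = (\<Sum>A\<in>Pow V. g A * (f A - f (transpose x y ` A)))"
    if "x \<in> V" "y \<in> V" for x y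
    using sum_Pow_transpose[OF that, of "\<lambda>A. f A * g (transpose x y ` A)"]
    by (simp add: algebra_simps sum_subtractf image_comp)
  show ?thesis by (simp add: sum_mult_laplacian *)
qed

lemma laplacian_linear:
  fixes g :: "nat \<Rightarrow> 'v \<Rightarrow> real"
  assumes V: "finite V" "A \<subseteq> V" and sym: "\<And>x y. x \<in> V \<Longrightarrow> y \<in> V \<Longrightarrow> w x y = w y x"
  shows "laplacian V w (\<lambda>A. \<Sum>x\<in>A. g (card A) x) A
       = (\<Sum>x\<in>A. 2 * (\<Sum>y\<in>V. w x y * (g (card A) x - g (card A) y)))"
proof -
  define u where "u = g (card A)"
  have A: "finite A" using V finite_subset by blast
  \<comment> \<open>If both sites are occupied, the two terms cancel. By symmetry of
    \<open>w\<close> they contribute equally to the double sum, hence the factor 2 in the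
    conclusion.\<close>
  have "(\<Sum>z\<in>A. u z) - (\<Sum>z\<in>transpose x y ` A. u z) = of_bool (x \<in> A) * (u x - u y) + of_bool (y \<in> A) * (u y - u x)"
    for x y
  proof (cases "x = y")
    case False
    then show ?thesis using A by (auto simp: transpose_image_eq sum.insert_if sum_diff1)
  qed auto
  then have "laplacian V w (\<lambda>A. \<Sum>x\<in>A. g (card A) x) A
      = (\<Sum>x\<in>V. \<Sum>y\<in>V. w x y * (of_bool (x \<in> A) * (u x - u y) + of_bool (y \<in> A) * (u y - u x)))"
    by (simp add: laplacian_def card_transpose_image u_def)
  also have "\<dots> = (\<Sum>x\<in>V. \<Sum>y\<in>V. w x y * (of_bool (x \<in> A) * (u x - u y)))
      + (\<Sum>x\<in>V. \<Sum>y\<in>V. w x y * (of_bool (y \<in> A) * (u y - u x)))"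
    by (simp add: distrib_left sum.distrib)
  also have "(\<Sum>x\<in>V. \<Sum>y\<in>V. w x y * (of_bool (y \<in> A) * (u y - u x)))
      = (\<Sum>x\<in>V. \<Sum>y\<in>V. w x y * (of_bool (x \<in> A) * (u x - u y)))"
    by (subst sum.swap) (simp add: sym cong: sum.cong)
  also have "(\<Sum>x\<in>V. \<Sum>y\<in>V. w x y * (of_bool (x \<in> A) * (u x - u y))) = (\<Sum>x\<in>A. \<Sum>y\<in>V. w x y * (u x - u y))"
    using V by (intro sum.mono_neutral_cong_right) auto
  finally show ?thesis by (simp add: u_def sum_distrib_left)
qed

section \<open>Comparison with the random walk\<close>

lemma configs_0: "finite V \<Longrightarrow> configs V 0 = {{}}"
  by (auto simp: configs_def dest: finite_subset)

text \<open>The factor 2 accounts for the double sum counting every edge twice.\<close>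
definition walk_gap :: "'v set \<Rightarrow> ('v \<Rightarrow> 'v \<Rightarrow> real) \<Rightarrow> real \<Rightarrow> bool" where
  "walk_gap V w c \<longleftrightarrow>
     (\<forall>g. (\<Sum>x\<in>V. g x) = 0 \<longrightarrow> 2 * c * (\<Sum>x\<in>V. (g x)^2) \<le> (\<Sum>x\<in>V. \<Sum>y\<in>V. w x y * (g x - g y)^2))"

lemma walk_form_eq:
  fixes w :: "'v \<Rightarrow> 'v \<Rightarrow> real"
  assumes sym: "\<And>x y. x \<in> V \<Longrightarrow> y \<in> V \<Longrightarrow> w x y = w y x"
  shows "(\<Sum>x\<in>V. g x * (2 * (\<Sum>y\<in>V. w x y * (g x - g y)))) = (\<Sum>x\<in>V. \<Sum>y\<in>V. w x y * (g x - g y)^2)"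
proof -
  have "(\<Sum>x\<in>V. \<Sum>y\<in>V. w x y * (g x * (g x - g y))) = (\<Sum>x\<in>V. \<Sum>y\<in>V. w x y * (g y * (g y - g x)))"
    by (subst sum.swap) (simp add: sym cong: sum.cong)
  moreover have "(\<Sum>x\<in>V. \<Sum>y\<in>V. w x y * (g x - g y)^2)
      = (\<Sum>x\<in>V. \<Sum>y\<in>V. w x y * (g x * (g x - g y))) + (\<Sum>x\<in>V. \<Sum>y\<in>V. w x y * (g y * (g y - g x)))"
    by (simp add: power2_eq_square algebra_simps flip: sum.distrib)
  moreover have "(\<Sum>x\<in>V. g x * (2 * (\<Sum>y\<in>V. w x y * (g x - g y)))) = 2 * (\<Sum>x\<in>V. \<Sum>y\<in>V. w x y * (g x * (g x - g y)))"
    by (simp add: sum_distrib_left mult_ac)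
  ultimately show ?thesis by simp
qed

text \<open>On level \<open>k\<close> both sides are the corresponding quantities of the walk for
  \<open>g k\<close>, multiplied by the same \<open>m \<ge> 0\<close>, so the gap carries over level
  by level.\<close>

lemma gap_on_linear:
  fixes g :: "nat \<Rightarrow> 'v \<Rightarrow> real"
  assumes V: "finite V" and sym: "\<And>x y. x \<in> V \<Longrightarrow> y \<in> V \<Longrightarrow> w x y = w y x"
    and gap: "walk_gap V w c" and g: "\<And>k. (\<Sum>x\<in>V. g k x) = 0"
  defines "l \<equiv> \<lambda>A. \<Sum>x\<in>A. g (card A) x"
  shows "2 * c * (\<Sum>A\<in>Pow V. (l A)^2) \<le> (\<Sum>A\<in>Pow V. l A * laplacian V w l A)"
proof -
  define b where "b k x = 2 * (\<Sum>y\<in>V. w x y * (g k x - g k y))" for k x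
  have level: "2 * c * (\<Sum>A\<in>configs V k. (l A)^2) \<le> (\<Sum>A\<in>configs V k. l A * laplacian V w l A)" for k
  proof (cases "k \<ge> 1")
    case False
    then have "k = 0" by simp
    then show ?thesis by (simp add: configs_0[OF V] l_def laplacian_def)
  next
    case True
    define m where "m = real ((card V - 2) choose (k - 1))"
    have "(\<Sum>A\<in>configs V k. (l A)^2) = (\<Sum>A\<in>configs V k. (\<Sum>x\<in>A. g k x) * (\<Sum>x\<in>A. g k x))"
      by (intro sum.cong) (auto simp: configs_def l_def power2_eq_square)
    also have "\<dots> = m * (\<Sum>x\<in>V. (g k x)^2)"
      unfolding m_def power2_eq_square by (rule sum_linear_linear[OF V g True])
    finally have 1: "(\<Sum>A\<in>configs V k. (l A)^2) = m * (\<Sum>x\<in>V. (g k x)^2)" .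
    have "(\<Sum>A\<in>configs V k. l A * laplacian V w l A) = (\<Sum>A\<in>configs V k. (\<Sum>x\<in>A. g k x) * (\<Sum>x\<in>A. b k x))"
    proof (rule sum.cong[OF refl])
      fix A assume "A \<in> configs V k"
      then show "l A * laplacian V w l A = (\<Sum>x\<in>A. g k x) * (\<Sum>x\<in>A. b k x)"
        using laplacian_linear[OF V _ sym, where A = A and g = g] by (simp add: l_def b_def configs_def)
    qed
    also have "\<dots> = m * (\<Sum>x\<in>V. g k x * b k x)"
      unfolding m_def by (rule sum_linear_linear[OF V g True])
    also have "(\<Sum>x\<in>V. g k x * b k x) = (\<Sum>x\<in>V. \<Sum>y\<in>V. w x y * (g k x - g k y)^2)"
      unfolding b_def by (rule walk_form_eq[OF sym])
    finally have 2: "(\<Sum>A\<in>configs V k. l A * laplacian V w l A) = m * (\<Sum>x\<in>V. \<Sum>y\<in>V. w x y * (g k x - g k y)^2)" .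
    have "2 * c * (\<Sum>x\<in>V. (g k x)^2) \<le> (\<Sum>x\<in>V. \<Sum>y\<in>V. w x y * (g k x - g k y)^2)"
      using gap g by (simp add: walk_gap_def)
    then have "m * (2 * c * (\<Sum>x\<in>V. (g k x)^2)) \<le> m * (\<Sum>x\<in>V. \<Sum>y\<in>V. w x y * (g k x - g k y)^2)"
      by (rule mult_left_mono) (simp add: m_def)
    then show ?thesis unfolding 1 2 by (simp add: mult_ac)
  qed
  show ?thesis
    unfolding sum_Pow_configs[OF V] sum_distrib_left[of _ _ "{..card V}"] by (intro sum_mono level)
qed

text \<open>A function on \<open>U\<close> is extended to \<open>z\<close> harmonically, by its weighted mean. If all weights at \<open>z\<close>
  vanish, the divisions by zero give the value \<open>0\<close> and the unchanged weights, as they should.\<close>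
lemma walk_gap_reduction:
  fixes w :: "'v \<Rightarrow> 'v \<Rightarrow> real"
  assumes U: "finite U" "z \<notin> U" and sym: "\<And>x y. x \<in> insert z U \<Longrightarrow> y \<in> insert z U \<Longrightarrow> w x y = w y x"
    and nonneg: "\<And>x y. x \<in> insert z U \<Longrightarrow> y \<in> insert z U \<Longrightarrow> w x y \<ge> 0"
    and gap: "walk_gap (insert z U) w c" "c \<ge> 0"
  shows "walk_gap U (\<lambda>x y. w x y + w z x * w z y / (\<Sum>x\<in>U. w z x)) c"
  unfolding walk_gap_def
proof (intro allI impI)
  fix g :: "'v \<Rightarrow> real" assume g: "(\<Sum>x\<in>U. g x) = 0"
  define s where "s = (\<Sum>x\<in>U. w z x)"
  define t where "t = (\<Sum>x\<in>U. w z x * g x)"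
  define n where "n = real (card (insert z U))"
  define G where "G = g(z := t / s)"
  define m where "m = (t / s) / n"
  have n: "n > 0" "n \<ge> 1" using U by (auto simp: n_def)
  have Gz: "G z = t / s" and GU: "\<And>x. x \<in> U \<Longrightarrow> G x = g x" using U by (auto simp: G_def)
  have Gsum: "(\<Sum>x\<in>insert z U. G x) = t / s"
    using U g by (simp add: Gz GU cong: sum.cong)
  then have "(\<Sum>x\<in>insert z U. G x - m) = 0" using n U by (simp add: sum_subtractf m_def n_def del: sum.insert)
  then have "2 * c * (\<Sum>x\<in>insert z U. (G x - m)^2)
      \<le> (\<Sum>x\<in>insert z U. \<Sum>y\<in>insert z U. w x y * ((G x - m) - (G y - m))^2)"
    using gap(1)[unfolded walk_gap_def, rule_format, of "\<lambda>x. G x - m"] by simp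
  then have le: "2 * c * (\<Sum>x\<in>insert z U. (G x - m)^2) \<le> (\<Sum>x\<in>insert z U. \<Sum>y\<in>insert z U. w x y * (G x - G y)^2)"
    by simp
  \<comment> \<open>The extension \<open>G\<close> is not centred. Centring costs
    \<open>(t/s)^2 / n\<close>, at most the \<open>(t/s)^2\<close> gained from the new site, so the
    norm does not drop below that of \<open>g\<close>.\<close>
  have "(\<Sum>x\<in>insert z U. (G x - m)^2) = (\<Sum>x\<in>insert z U. (G x)^2) - 2 * m * (\<Sum>x\<in>insert z U. G x) + n * m^2"
    by (simp add: power2_diff sum_subtractf sum.distrib n_def sum_distrib_left mult_ac del: sum.insert)
  also have "\<dots> = (\<Sum>x\<in>insert z U. (G x)^2) - (t/s)^2 / n"
    using n unfolding Gsum m_def by (simp add: field_simps power2_eq_square)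
  also have "(\<Sum>x\<in>insert z U. (G x)^2) = (\<Sum>x\<in>U. (g x)^2) + (t/s)^2"
    using U by (simp add: Gz GU cong: sum.cong)
  also have "(\<Sum>x\<in>U. (g x)^2) + (t/s)^2 - (t/s)^2 / n \<ge> (\<Sum>x\<in>U. (g x)^2)"
    using n mult_left_mono[of 1 n "(t/s)^2"] by (simp add: pos_divide_le_eq del: power_divide)
  finally have 1: "2 * c * (\<Sum>x\<in>U. (g x)^2) \<le> 2 * c * (\<Sum>x\<in>insert z U. (G x - m)^2)"
    using gap(2) by (simp add: mult_left_mono)
  have "(\<Sum>x\<in>insert z U. \<Sum>y\<in>insert z U. w x y * (G x - G y)^2)
      = (\<Sum>y\<in>U. w z y * (t/s - g y)^2) + (\<Sum>x\<in>U. w x z * (g x - t/s)^2 + (\<Sum>y\<in>U. w x y * (g x - g y)^2))"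
    using U by (simp add: Gz GU cong: sum.cong)
  also have "\<dots> = 2 * (\<Sum>x\<in>U. w z x * (g x - t/s)^2) + (\<Sum>x\<in>U. \<Sum>y\<in>U. w x y * (g x - g y)^2)"
    using sym by (simp add: sum.distrib power2_commute cong: sum.cong)
  \<comment> \<open>The variance identity: for the probability weights \<open>w z x / s\<close> with
    mean \<open>t / s\<close>, twice the variance is the mean squared difference of two independent
    samples.\<close>
  also have "2 * (\<Sum>x\<in>U. w z x * (g x - t/s)^2) = (\<Sum>x\<in>U. \<Sum>y\<in>U. w z x * w z y / s * (g x - g y)^2)"
  proof (cases "s = 0")
    case True
    then have "\<forall>x\<in>U. w z x = 0"
      using nonneg sum_nonneg_eq_0_iff[OF U(1), of "w z"] by (auto simp: s_def)
    then show ?thesis by simp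
  next
    case False
    define q where "q = (\<Sum>x\<in>U. w z x * (g x)^2)"
    have "(\<Sum>x\<in>U. w z x * (g x - r)^2) = q - 2 * r * t + r^2 * s" for r
    proof -
      have "(\<Sum>x\<in>U. w z x * (g x - r)^2) = (\<Sum>x\<in>U. w z x * (g x)^2 - 2 * r * (w z x * g x) + r^2 * w z x)"
        by (intro sum.cong refl) (simp add: power2_diff algebra_simps)
      then show ?thesis by (simp add: q_def s_def t_def sum_subtractf sum.distrib flip: sum_distrib_left)
    qed
    then have "(\<Sum>x\<in>U. w z x * (g x - t/s)^2) = q - 2 * (t/s) * t + (t/s)^2 * s" .
    also have "\<dots> = q - t^2 / s" using False by (simp add: field_simps power2_eq_square)
    finally have a: "(\<Sum>x\<in>U. w z x * (g x - t/s)^2) = q - t^2 / s" .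
    have "(\<Sum>x\<in>U. \<Sum>y\<in>U. w z x * w z y * (g x - g y)^2)
        = (\<Sum>x\<in>U. \<Sum>y\<in>U. (w z x * (g x)^2) * w z y + w z x * (w z y * (g y)^2) - 2 * ((w z x * g x) * (w z y * g y)))"
      by (simp add: power2_diff algebra_simps)
    also have "\<dots> = q * s + s * q - 2 * (t * t)"
      unfolding q_def s_def t_def sum_product by (simp add: sum.distrib sum_subtractf sum_distrib_left)
    finally have "(\<Sum>x\<in>U. \<Sum>y\<in>U. w z x * w z y * (g x - g y)^2) / s = 2 * (q - t^2 / s)"
      using False by (simp add: field_simps power2_eq_square)
    then show ?thesis unfolding a by (simp add: sum_divide_distrib)
  qed
  finally have "(\<Sum>x\<in>insert z U. \<Sum>y\<in>insert z U. w x y * (G x - G y)^2)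
      = (\<Sum>x\<in>U. \<Sum>y\<in>U. (w x y + w z x * w z y / s) * (g x - g y)^2)"
    by (simp add: distrib_right sum.distrib)
  with le 1 show "2 * c * (\<Sum>x\<in>U. (g x)^2)
      \<le> (\<Sum>x\<in>U. \<Sum>y\<in>U. (w x y + w z x * w z y / (\<Sum>x\<in>U. w z x)) * (g x - g y)^2)"
    by (simp add: s_def)
qed

section \<open>The exclusion form under elimination of a vertex\<close>

lemma swap_energy_self: "swap_energy V f x x = 0"
  by (simp add: swap_energy_def)

lemma swap_energy_commute: "swap_energy V f x y = swap_energy V f y x"
  by (simp add: swap_energy_def transpose_commute)

lemma swap_energy_insert:
  assumes "finite U" "z \<notin> U" "x \<in> U" "y \<in> U"
  shows "swap_energy (insert z U) f x y = swap_energy U f x y + swap_energy U (\<lambda>A. f (insert z A)) x y"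
  using assms by (simp add: swap_energy_def sum_Pow_insert sum.distrib transpose_apply_other)
    (metis transpose_apply_other)

text \<open>The octopus inequality with \<open>c = w z\<close>, divided by the total weight at
  \<open>z\<close>, bounds exactly the added weights by the removed edges at \<open>z\<close>; pairs
  inside \<open>U\<close> occur on both sides.\<close>

lemma form_reduction:
  fixes w :: "'v \<Rightarrow> 'v \<Rightarrow> real"
  assumes U: "finite U" "z \<notin> U" and sym: "\<And>x y. x \<in> insert z U \<Longrightarrow> y \<in> insert z U \<Longrightarrow> w x y = w y x"
    and nonneg: "\<And>x y. x \<in> insert z U \<Longrightarrow> y \<in> insert z U \<Longrightarrow> w x y \<ge> 0"
  shows "(\<Sum>x\<in>U. \<Sum>y\<in>U. (w x y + w z x * w z y / (\<Sum>x\<in>U. w z x)) * swap_energy (insert z U) f x y)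
     \<le> (\<Sum>x\<in>insert z U. \<Sum>y\<in>insert z U. w x y * swap_energy (insert z U) f x y)"
proof -
  define e where "e = swap_energy (insert z U) f"
  define s where "s = (\<Sum>x\<in>U. w z x)"
  have ez: "e z z = 0" and ecomm: "e x y = e y x" for x y
    by (simp_all add: e_def swap_energy_self swap_energy_commute)
  have s: "s \<ge> 0" unfolding s_def by (intro sum_nonneg nonneg) auto
  have "(\<Sum>i\<in>U. \<Sum>j\<in>U. w z i * w z j * e i j) \<le> 2 * s * (\<Sum>i\<in>U. w z i * e z i)"
    using octopus_inequality[of "insert z U" z "w z" f] U nonneg by (simp add: e_def s_def)
  then have *: "(\<Sum>i\<in>U. \<Sum>j\<in>U. w z i * w z j / s * e i j) \<le> 2 * (\<Sum>i\<in>U. w z i * e z i)"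
  proof (cases "s = 0")
    case True
    then have "\<forall>x\<in>U. w z x = 0"
      using nonneg sum_nonneg_eq_0_iff[OF U(1), of "w z"] by (auto simp: s_def)
    then show ?thesis by simp
  next
    case False
    then have "s > 0" using s by simp
    assume "(\<Sum>i\<in>U. \<Sum>j\<in>U. w z i * w z j * e i j) \<le> 2 * s * (\<Sum>i\<in>U. w z i * e z i)"
    then have "(\<Sum>i\<in>U. \<Sum>j\<in>U. w z i * w z j * e i j) / s \<le> 2 * (\<Sum>i\<in>U. w z i * e z i)"
      using \<open>s > 0\<close> by (simp add: pos_divide_le_eq mult_ac)
    then show ?thesis by (simp add: sum_divide_distrib)
  qed
  have "(\<Sum>x\<in>insert z U. \<Sum>y\<in>insert z U. w x y * e x y)
      = 2 * (\<Sum>x\<in>U. w z x * e z x) + (\<Sum>x\<in>U. \<Sum>y\<in>U. w x y * e x y)"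
  proof -
    have "w x z = w z x" "e x z = e z x" if "x \<in> U" for x
      using sym[of x z] ecomm that by auto
    then show ?thesis using U by (simp add: ez sum.distrib cong: sum.cong)
  qed
  with * show ?thesis
    by (simp add: e_def s_def distrib_right sum.distrib)
qed

text \<open>All numbers of black balls are treated at once, with mean zero on each level, because
  fixing the content of \<open>z\<close> turns level \<open>k\<close> into levels \<open>k\<close>
  and \<open>k - 1\<close> of \<open>U\<close>. The induction hypothesis is then applied to
  \<open>h\<close> with \<open>z\<close> white and with \<open>z\<close> black.\<close>

lemma exclusion_poincare:
  fixes w :: "'v \<Rightarrow> 'v \<Rightarrow> real"
  assumes "finite V" and "c \<ge> 0"
    and "\<And>x y. x \<in> V \<Longrightarrow> y \<in> V \<Longrightarrow> w x y = w y x"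
    and "\<And>x y. x \<in> V \<Longrightarrow> y \<in> V \<Longrightarrow> w x y \<ge> 0"
    and "walk_gap V w c"
    and "\<And>k. (\<Sum>A\<in>configs V k. f A) = 0"
  shows "2 * c * (\<Sum>A\<in>Pow V. (f A)^2) \<le> (\<Sum>x\<in>V. \<Sum>y\<in>V. w x y * swap_energy V f x y)"
  using assms(1,3-)
proof (induction V arbitrary: w f rule: finite_induct)
  case empty
  then show ?case using empty(4)[of 0] by (simp add: configs_0)
next
  case (insert z U)
  note sym = insert.prems(1) and nonneg = insert.prems(2) and gap = insert.prems(3) and f0 = insert.prems(4)
  define V where "V = insert z U"
  have V: "finite V" using insert by (simp add: V_def)
  have "\<exists>g. (\<Sum>x\<in>V. g x) = 0 \<and> (\<forall>x\<in>V. (\<Sum>A\<in>{A \<in> configs V k. x \<in> A}. f A - (\<Sum>y\<in>A. g y)) = 0)" for k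
    using linear_projection[OF V f0[folded V_def], of k] by metis
  then obtain g where g: "\<And>k. (\<Sum>x\<in>V. g k x) = 0"
    and gh: "\<And>k x. x \<in> V \<Longrightarrow> (\<Sum>A\<in>{A \<in> configs V k. x \<in> A}. f A - (\<Sum>y\<in>A. g k y)) = 0"
    by metis
  define l where "l A = (\<Sum>x\<in>A. g (card A) x)" for A
  define h where "h A = f A - l A" for A
  have fh: "f A = l A + h A" for A by (simp add: h_def)
  have h1: "(\<Sum>A\<in>{A \<in> configs V k. x \<in> A}. h A) = 0" if "x \<in> V" for x k
  proof -
    have "(\<Sum>A\<in>{A \<in> configs V k. x \<in> A}. h A) = (\<Sum>A\<in>{A \<in> configs V k. x \<in> A}. f A - (\<Sum>y\<in>A. g k y))"
      by (intro sum.cong) (auto simp: h_def l_def configs_def)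
    then show ?thesis using gh[OF that] by simp
  qed
  have h_linear: "(\<Sum>A\<in>Pow V. h A * (\<Sum>x\<in>A. b (card A) x)) = 0" for b
  proof -
    have "(\<Sum>A\<in>configs V k. h A * (\<Sum>x\<in>A. b (card A) x)) = 0" for k
    proof -
      have "(\<Sum>A\<in>configs V k. h A * (\<Sum>x\<in>A. b (card A) x)) = (\<Sum>A\<in>configs V k. h A * (\<Sum>x\<in>A. b k x))"
        by (intro sum.cong) (auto simp: configs_def)
      then show ?thesis by (simp add: sum_linear_mult[OF V] h1)
    qed
    then show ?thesis by (simp add: sum_Pow_configs[OF V])
  qed
  \<comment> \<open>With \<open>h1\<close> at \<open>z\<close>, this yields by subtraction mean zero
    on the configurations avoiding \<open>z\<close>.\<close>
  have h0: "(\<Sum>A\<in>configs V k. h A) = 0" for k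
  proof -
    have "(\<Sum>A\<in>configs V k. l A) = (\<Sum>A\<in>configs V k. 1 * (\<Sum>x\<in>A. g k x))"
      by (intro sum.cong) (auto simp: l_def configs_def)
    also have "\<dots> = (\<Sum>x\<in>V. g k x * (\<Sum>A\<in>{A \<in> configs V k. x \<in> A}. 1))"
      by (rule sum_linear_mult[OF V])
    also have "\<dots> = 0"
    proof (cases "k \<ge> 1")
      case True
      then have "(\<Sum>x\<in>V. g k x * (\<Sum>A\<in>{A \<in> configs V k. x \<in> A}. 1)) = (\<Sum>x\<in>V. g k x * real ((card V - 1) choose (k - 1)))"
        by (intro sum.cong refl) (simp add: card_configs_with[OF V])
      then show ?thesis using g by (simp flip: sum_distrib_right)
    next
      case False
      then have "{A \<in> configs V k. x \<in> A} = {}" for x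
        using configs_0[OF V] by (cases k) auto
      then show ?thesis by (simp only: sum.empty mult_zero_right sum.neutral_const)
    qed
    finally show ?thesis using f0 by (simp add: h_def sum_subtractf V_def)
  qed
  have U: "finite U" "z \<notin> U" using insert by auto
  have conf_out: "configs U k = {A \<in> configs V k. z \<notin> A}" for k
    using U by (auto simp: configs_def V_def)
  have "(\<Sum>A\<in>configs U k. h A) = 0" for k
  proof -
    have "configs V k = configs U k \<union> {A \<in> configs V k. z \<in> A}" "configs U k \<inter> {A \<in> configs V k. z \<in> A} = {}"
      by (auto simp: conf_out)
    then have "(\<Sum>A\<in>configs V k. h A) = (\<Sum>A\<in>configs U k. h A) + (\<Sum>A\<in>{A \<in> configs V k. z \<in> A}. h A)"
      using finite_configs[OF V] finite_configs[OF U(1)] by (metis finite_Un sum.union_disjoint)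
    then show ?thesis using h0 h1[of z k] by (simp add: V_def)
  qed
  moreover have "(\<Sum>A\<in>configs U k. h (insert z A)) = 0" for k
  proof -
    have "(\<Sum>A\<in>configs U k. h (insert z A)) = (\<Sum>A\<in>{A \<in> configs V (Suc k). z \<in> A}. h A)"
      by (rule sum.reindex_bij_witness[where i = "\<lambda>A. A - {z}" and j = "insert z"])
         (use U in \<open>auto simp: configs_def V_def card_insert_if finite_subset insert_absorb\<close>)
    then show ?thesis using h1[of z "Suc k"] by (simp add: V_def)
  qed
  moreover define w' where "w' x y = w x y + w z x * w z y / (\<Sum>x\<in>U. w z x)" for x y
  have w': "w' x y = w' y x" "w' x y \<ge> 0" if "x \<in> U" "y \<in> U" for x y
    using sym[of x y] nonneg[of x y] nonneg[of z x] nonneg[of z y] that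
    by (auto simp: w'_def mult_ac intro!: add_nonneg_nonneg divide_nonneg_nonneg sum_nonneg nonneg)
  moreover have "walk_gap U w' c"
    unfolding w'_def by (rule walk_gap_reduction[OF U sym nonneg gap assms(2)])
  ultimately have IH:
    "2 * c * (\<Sum>A\<in>Pow U. (h A)^2) \<le> (\<Sum>x\<in>U. \<Sum>y\<in>U. w' x y * swap_energy U h x y)"
    "2 * c * (\<Sum>A\<in>Pow U. (h (insert z A))^2) \<le> (\<Sum>x\<in>U. \<Sum>y\<in>U. w' x y * swap_energy U (\<lambda>A. h (insert z A)) x y)"
    using insert.IH[of w' h] insert.IH[of w' "\<lambda>A. h (insert z A)"] by simp_all
  have "2 * c * (\<Sum>A\<in>Pow V. (h A)^2)
      = 2 * c * (\<Sum>A\<in>Pow U. (h A)^2) + 2 * c * (\<Sum>A\<in>Pow U. (h (insert z A))^2)"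
    using U by (simp add: V_def sum_Pow_insert sum.distrib distrib_left)
  also have "\<dots> \<le> (\<Sum>x\<in>U. \<Sum>y\<in>U. w' x y * swap_energy U h x y)
      + (\<Sum>x\<in>U. \<Sum>y\<in>U. w' x y * swap_energy U (\<lambda>A. h (insert z A)) x y)"
    using IH by (rule add_mono)
  also have "\<dots> = (\<Sum>x\<in>U. \<Sum>y\<in>U. w' x y * swap_energy V h x y)"
    using U by (simp add: V_def swap_energy_insert distrib_left sum.distrib)
  also have "\<dots> \<le> (\<Sum>x\<in>V. \<Sum>y\<in>V. w x y * swap_energy V h x y)"
    unfolding V_def w'_def by (rule form_reduction[OF U sym nonneg])
  also have "\<dots> = (\<Sum>A\<in>Pow V. h A * laplacian V w h A)"
    by (simp add: sum_mult_laplacian swap_energy_def)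
  finally have h: "2 * c * (\<Sum>A\<in>Pow V. (h A)^2) \<le> (\<Sum>A\<in>Pow V. h A * laplacian V w h A)" .
  have l: "2 * c * (\<Sum>A\<in>Pow V. (l A)^2) \<le> (\<Sum>A\<in>Pow V. l A * laplacian V w l A)"
    unfolding l_def by (rule gap_on_linear[OF V sym[folded V_def] gap[folded V_def] g])
  \<comment> \<open>The Laplacian of \<open>l\<close> is again linear, with coefficients
    \<open>b\<close>. Hence it is orthogonal to \<open>h\<close>, and the form splits without cross
    terms.\<close>
  define b where "b k x = 2 * (\<Sum>y\<in>V. w x y * (g k x - g k y))" for k x
  have "(\<Sum>A\<in>Pow V. h A * laplacian V w l A) = (\<Sum>A\<in>Pow V. h A * (\<Sum>x\<in>A. b (card A) x))"
    unfolding l_def b_def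
    by (intro sum.cong refl) (simp add: laplacian_linear[OF V _ sym[folded V_def], where g = g])
  then have hl: "(\<Sum>A\<in>Pow V. h A * laplacian V w l A) = 0" by (simp add: h_linear)
  have "(\<Sum>A\<in>Pow V. (f A)^2) = (\<Sum>A\<in>Pow V. (l A)^2) + (\<Sum>A\<in>Pow V. (h A)^2) + 2 * (\<Sum>A\<in>Pow V. h A * l A)"
    by (simp add: fh power2_sum sum.distrib sum_distrib_left mult_ac)
  also have "(\<Sum>A\<in>Pow V. h A * l A) = 0" unfolding l_def by (rule h_linear)
  finally have norm: "(\<Sum>A\<in>Pow V. (f A)^2) = (\<Sum>A\<in>Pow V. (l A)^2) + (\<Sum>A\<in>Pow V. (h A)^2)" by simp
  have lap: "laplacian V w f A = laplacian V w l A + laplacian V w h A" for A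
    by (simp add: laplacian_def fh algebra_simps flip: sum.distrib)
  have "(\<Sum>A\<in>Pow V. f A * laplacian V w f A)
      = (\<Sum>A\<in>Pow V. l A * laplacian V w l A) + (\<Sum>A\<in>Pow V. h A * laplacian V w h A)
        + (\<Sum>A\<in>Pow V. h A * laplacian V w l A) + (\<Sum>A\<in>Pow V. l A * laplacian V w h A)"
    by (simp add: lap fh distrib_left distrib_right sum.distrib)
  also have "(\<Sum>A\<in>Pow V. l A * laplacian V w h A) = 0"
    using hl laplacian_symmetric[OF V, of l w h] by simp
  finally have "(\<Sum>A\<in>Pow V. f A * laplacian V w f A)
      = (\<Sum>A\<in>Pow V. l A * laplacian V w l A) + (\<Sum>A\<in>Pow V. h A * laplacian V w h A)"
    using hl by simp
  then have "2 * c * (\<Sum>A\<in>Pow V. (f A)^2) \<le> (\<Sum>A\<in>Pow V. f A * laplacian V w f A)"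
    using l h unfolding norm by (simp add: distrib_left)
  then show ?case by (simp add: sum_mult_laplacian swap_energy_def V_def)
qed

section \<open>A Poincare inequality on the grid\<close>

lemma power2_diff_le_path:
  fixes h :: "nat \<Rightarrow> real"
  assumes "a < L" "b < L"
  shows "(h a - h b)^2 \<le> L * (\<Sum>t<L - 1. (h (Suc t) - h t)^2)"
proof -
  have *: "(h b - h a)^2 \<le> L * (\<Sum>t<L - 1. (h (Suc t) - h t)^2)" if "a \<le> b" "b < L" for a b
  proof -
    have "(h b - h a)^2 = (\<Sum>t=a..<b. h (Suc t) - h t)^2"
      using that by (simp add: sum_Suc_diff')
    also have "\<dots> \<le> real (card {a..<b}) * (\<Sum>t=a..<b. (h (Suc t) - h t)^2)"
      using sum_squared_le_sum_of_squares[of "\<lambda>t. h (Suc t) - h t" "{a..<b}"] by (simp add: mult.commute)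
    also have "\<dots> \<le> L * (\<Sum>t<L - 1. (h (Suc t) - h t)^2)"
      using that by (intro mult_mono sum_mono2) (auto intro: sum_nonneg)
    finally show ?thesis .
  qed
  show ?thesis using *[of a b] *[of b a] assms by (cases "a \<le> b") (auto simp: power2_commute)
qed

text \<open>Twice the left side minus twice the square of the sum is the double sum of
  \<open>(h a - h b)^2\<close>, whose \<open>L^2\<close> terms are each at most \<open>L\<close>
  times the path energy. The square of the sum is kept so that the bound applies to slice
  sums.\<close>

lemma path_poincare:
  fixes h :: "nat \<Rightarrow> real"
  shows "L * (\<Sum>a<L. (h a)^2) \<le> (\<Sum>a<L. h a)^2 + L * (real L^2 / 2) * (\<Sum>t<L - 1. (h (Suc t) - h t)^2)"
proof -
  define D where "D = (\<Sum>t<L - 1. (h (Suc t) - h t)^2)"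
  have "(\<Sum>a<L. \<Sum>b<L. (h a - h b)^2) \<le> (\<Sum>a<L. \<Sum>b<L. L * D)"
    unfolding D_def by (intro sum_mono power2_diff_le_path) auto
  also have "\<dots> = 2 * (L * (real L^2 / 2) * D)" by (simp add: power2_eq_square)
  also have "(\<Sum>a<L. \<Sum>b<L. (h a - h b)^2) = 2 * (L * (\<Sum>a<L. (h a)^2) - (\<Sum>a<L. h a)^2)"
  proof -
    have "(\<Sum>a<L. \<Sum>b<L. (h a - h b)^2) = (\<Sum>a<L. \<Sum>b<L. (h a)^2 + (h b)^2 - 2 * (h a * h b))"
      by (intro sum.cong refl) (simp add: power2_diff)
    also have "\<dots> = 2 * (L * (\<Sum>a<L. (h a)^2) - (\<Sum>a<L. h a)^2)"
      by (simp add: sum.distrib sum_subtractf power2_eq_square sum_product flip: sum_distrib_left)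
    finally show ?thesis .
  qed
  finally show ?thesis by (simp add: D_def)
qed

section \<open>Tensorisation over the coordinates\<close>

lemma sum_torus_verts_Suc:
  "(\<Sum>x\<in>torus_verts (Suc d) L. F x) = (\<Sum>a<L. \<Sum>x\<in>torus_verts d L. F (x(d := a)))"
proof -
  have "torus_verts (Suc d) L = (\<lambda>(a, x). x(d := a)) ` ({..<L} \<times> torus_verts d L)"
    unfolding torus_verts_def lessThan_Suc by (rule PiE_insert_eq)
  moreover have "inj_on (\<lambda>(a, x). x(d := a)) ({..<L} \<times> torus_verts d L)"
    unfolding torus_verts_def by (rule inj_combinator) simp
  ultimately show ?thesis
    by (simp add: sum.reindex sum.cartesian_product case_prod_unfold)
qed

text \<open>Upward steps only, without wrapping around: paths instead of cycles, which suffices for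
  a lower bound and makes \<open>L = 2\<close> no special case.\<close>

definition path_form :: "nat \<Rightarrow> nat \<Rightarrow> ((nat \<Rightarrow> nat) \<Rightarrow> real) \<Rightarrow> real" where
  "path_form d L g = (\<Sum>i<d. \<Sum>x\<in>torus_verts d L. if Suc (x i) < L then (g (x(i := Suc (x i))) - g x)^2 else 0)"

lemma path_form_Suc:
  "path_form (Suc d) L g = (\<Sum>a<L. path_form d L (\<lambda>x. g (x(d := a))))
     + (\<Sum>t<L - 1. \<Sum>x\<in>torus_verts d L. (g (x(d := Suc t)) - g (x(d := t)))^2)"
proof -
  have "(\<Sum>a<L. \<Sum>x\<in>torus_verts d L. if Suc a < L then (g (x(d := Suc a)) - g (x(d := a)))^2 else 0)
     = (\<Sum>t<L - 1. \<Sum>x\<in>torus_verts d L. (g (x(d := Suc t)) - g (x(d := t)))^2)"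
  proof -
    have iff: "Suc a < L \<longleftrightarrow> a < L - 1" for a by linarith
    show ?thesis unfolding iff by (rule sum.mono_neutral_cong_right) auto
  qed
  moreover have "(\<Sum>i<d. \<Sum>a<L. \<Sum>x\<in>torus_verts d L.
        if Suc ((x(d := a)) i) < L then (g (x(d := a, i := Suc ((x(d := a)) i))) - g (x(d := a)))^2 else 0)
     = (\<Sum>i<d. \<Sum>a<L. \<Sum>x\<in>torus_verts d L.
        if Suc (x i) < L then (g ((x(i := Suc (x i)))(d := a)) - g (x(d := a)))^2 else 0)"
  proof (intro sum.cong refl)
    fix i a and x :: "nat \<Rightarrow> nat" assume "i \<in> {..<d}"
    then have "x(d := a, i := c) = x(i := c, d := a)" "(x(d := a)) i = x i" for c
      by (auto intro!: fun_upd_twist)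
    then show "(if Suc ((x(d := a)) i) < L then (g (x(d := a, i := Suc ((x(d := a)) i))) - g (x(d := a)))^2 else 0)
        = (if Suc (x i) < L then (g ((x(i := Suc (x i)))(d := a)) - g (x(d := a)))^2 else 0)"
      by presburger
  qed
  moreover have "\<dots> = (\<Sum>a<L. path_form d L (\<lambda>x. g (x(d := a))))"
    unfolding path_form_def by (rule sum.swap)
  ultimately show ?thesis
    by (simp add: path_form_def[of "Suc d"] sum_torus_verts_Suc del: fun_upd_apply)
      (simp only: fun_upd_same fun_upd_upd add.commute)
qed

text \<open>The variance splits into the part inside the slices of fixed last coordinate, bounded by
  induction, and the part of the slice sums \<open>S\<close>, bounded by
  \<open>path_poincare\<close>. Each direction enters the form additively, so the constant does not
  grow with \<open>d\<close>.\<close>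

lemma grid_poincare:
  "real L ^ d * (\<Sum>x\<in>torus_verts d L. (g x)^2)
     \<le> (\<Sum>x\<in>torus_verts d L. g x)^2 + real L ^ d * (real L^2 / 2) * path_form d L g"
proof (induction d arbitrary: g)
  case 0
  then show ?case by (simp add: torus_verts_def path_form_def)
next
  case (Suc d)
  define N where "N = real L ^ d"
  define S where "S a = (\<Sum>x\<in>torus_verts d L. g (x(d := a)))" for a
  define P where "P = (\<Sum>a<L. path_form d L (\<lambda>x. g (x(d := a))))"
  define Q where "Q = (\<Sum>t<L - 1. \<Sum>x\<in>torus_verts d L. (g (x(d := Suc t)) - g (x(d := t)))^2)"
  have card: "real (card (torus_verts d L)) = N" by (simp add: torus_verts_def card_PiE N_def)
  have "N * (\<Sum>a<L. \<Sum>x\<in>torus_verts d L. (g (x(d := a)))^2)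
      \<le> (\<Sum>a<L. (S a)^2 + N * (real L^2 / 2) * path_form d L (\<lambda>x. g (x(d := a))))"
    unfolding sum_distrib_left[of N _ "{..<L}"] unfolding S_def N_def
    by (rule sum_mono) (rule Suc.IH)
  also have "\<dots> = (\<Sum>a<L. (S a)^2) + N * (real L^2 / 2) * P"
    by (simp add: sum.distrib P_def sum_distrib_left)
  finally have 1: "L * (N * (\<Sum>a<L. \<Sum>x\<in>torus_verts d L. (g (x(d := a)))^2))
      \<le> L * ((\<Sum>a<L. (S a)^2) + N * (real L^2 / 2) * P)"
    by (rule mult_left_mono) simp
  \<comment> \<open>Cauchy-Schwarz over the \<open>N\<close> points of a slice.\<close>
  have "(S (Suc t) - S t)^2 \<le> N * (\<Sum>x\<in>torus_verts d L. (g (x(d := Suc t)) - g (x(d := t)))^2)" for t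
    using sum_squared_le_sum_of_squares[of "\<lambda>x. g (x(d := Suc t)) - g (x(d := t))" "torus_verts d L"]
    by (simp add: S_def sum_subtractf card mult.commute)
  then have "(\<Sum>t<L - 1. (S (Suc t) - S t)^2) \<le> N * Q"
    unfolding Q_def sum_distrib_left[of N _ "{..<L - 1}"] by (intro sum_mono)
  then have "L * (real L^2 / 2) * (\<Sum>t<L - 1. (S (Suc t) - S t)^2) \<le> L * (real L^2 / 2) * (N * Q)"
    by (rule mult_left_mono) simp
  then have 2: "L * (\<Sum>a<L. (S a)^2) \<le> (\<Sum>a<L. S a)^2 + L * (real L^2 / 2) * (N * Q)"
    using path_poincare[of L S] by linarith
  have "real L ^ Suc d * (\<Sum>x\<in>torus_verts (Suc d) L. (g x)^2)
      = L * (N * (\<Sum>a<L. \<Sum>x\<in>torus_verts d L. (g (x(d := a)))^2))"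
    by (simp add: sum_torus_verts_Suc N_def)
  also have "\<dots> \<le> (\<Sum>a<L. S a)^2 + L * (real L^2 / 2) * (N * Q) + L * (N * (real L^2 / 2) * P)"
    using 1 2 by (simp add: distrib_left)
  also have "\<dots> = (\<Sum>x\<in>torus_verts (Suc d) L. g x)^2 + real L ^ Suc d * (real L^2 / 2) * path_form (Suc d) L g"
  proof -
    have "path_form (Suc d) L g = P + Q" by (simp add: path_form_Suc P_def Q_def)
    moreover have "(\<Sum>x\<in>torus_verts (Suc d) L. g x) = (\<Sum>a<L. S a)" by (simp add: sum_torus_verts_Suc S_def)
    ultimately show ?thesis by (simp add: N_def[symmetric] algebra_simps)
  qed
  finally show ?case .
qed

section \<open>The spectral gap\<close>

definition edge_weight :: "'v set set \<Rightarrow> 'v \<Rightarrow> 'v \<Rightarrow> real" where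
  "edge_weight E x y = of_bool (x \<noteq> y \<and> {x, y} \<in> E)"

lemma edge_weight_commute: "edge_weight E x y = edge_weight E y x"
  by (auto simp: edge_weight_def insert_commute)

lemma edge_weight_nonneg: "edge_weight E x y \<ge> 0"
  by (simp add: edge_weight_def)

definition edges_on :: "'v set \<Rightarrow> 'v set set \<Rightarrow> bool" where
  "edges_on V E \<longleftrightarrow> (\<forall>e\<in>E. \<exists>x\<in>V. \<exists>y\<in>V. x \<noteq> y \<and> e = {x, y})"

lemma switch_pair: "x \<noteq> y \<Longrightarrow> switch {x, y} = (`) (transpose x y)"
  by (auto simp: switch_def edge_swap_def transpose_def fun_eq_iff insert_Diff_if intro!: image_cong)

lemma finite_edges: "finite V \<Longrightarrow> edges_on V E \<Longrightarrow> finite E"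
  by (rule finite_subset[of _ "Pow V"]) (auto simp: edges_on_def)

text \<open>Each edge comes from two ordered pairs; this is the source of the factors 2 in
  \<open>laplacian_eq_generator\<close>.\<close>

lemma sum_edges:
  assumes V: "finite V" and E: "edges_on V E"
  shows "(\<Sum>x\<in>V. \<Sum>y\<in>V. edge_weight E x y * F {x, y}) = 2 * (\<Sum>e\<in>E. F e)"
proof -
  define T where "T = {p \<in> V \<times> V. fst p \<noteq> snd p \<and> {fst p, snd p} \<in> E}"
  have T: "finite T" using V by (simp add: T_def)
  have "(\<Sum>x\<in>V. \<Sum>y\<in>V. edge_weight E x y * F {x, y}) = (\<Sum>p\<in>V \<times> V. edge_weight E (fst p) (snd p) * F {fst p, snd p})"
    by (simp add: sum.cartesian_product case_prod_unfold)
  also have "\<dots> = (\<Sum>p\<in>T. F {fst p, snd p})"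
    using V by (intro sum.mono_neutral_cong_right) (auto simp: T_def edge_weight_def)
  also have "\<dots> = (\<Sum>e\<in>E. \<Sum>p\<in>{p \<in> T. {fst p, snd p} = e}. F {fst p, snd p})"
    using T finite_edges[OF V E] by (intro sum.group[symmetric]) (auto simp: T_def)
  also have "\<dots> = (\<Sum>e\<in>E. 2 * F e)"
  proof (rule sum.cong[OF refl])
    fix e assume e: "e \<in> E"
    then obtain a b where ab: "a \<in> V" "b \<in> V" "a \<noteq> b" "e = {a, b}" using E by (auto simp: edges_on_def)
    then have "{p \<in> T. {fst p, snd p} = e} = {(a, b), (b, a)}"
      using e by (auto simp: T_def doubleton_eq_iff insert_commute)
    then show "(\<Sum>p\<in>{p \<in> T. {fst p, snd p} = e}. F {fst p, snd p}) = 2 * F e"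
      using ab by (simp add: insert_commute)
  qed
  finally show ?thesis by (simp add: sum_distrib_left)
qed

lemma laplacian_eq_generator:
  assumes "finite V" "edges_on V E"
  shows "laplacian V (edge_weight E) f A = - 2 * exclusion_generator E f A"
proof -
  have eq: "edge_weight E x y * (f A - f (transpose x y ` A)) = edge_weight E x y * (f A - f (switch {x, y} A))" for x y
    by (cases "x = y") (simp_all add: edge_weight_def switch_pair)
  have "laplacian V (edge_weight E) f A = 2 * (\<Sum>e\<in>E. f A - f (switch e A))"
    unfolding laplacian_def eq by (rule sum_edges[OF assms])
  then show ?thesis by (simp add: exclusion_generator_def sum_subtractf)
qed

lemma switch_in_configs:
  assumes "edges_on V E" "e \<in> E"
  shows "switch e A \<in> configs V k \<longleftrightarrow> A \<in> configs V k"
proof -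
  obtain x y where "x \<in> V" "y \<in> V" "x \<noteq> y" "e = {x, y}" using assms by (auto simp: edges_on_def)
  then show ?thesis by (simp add: switch_pair configs_def transpose_image_subset_iff card_transpose_image)
qed

lemma generator_restrict:
  assumes "edges_on V E"
  shows "exclusion_generator E (\<lambda>A. if A \<in> configs V k then f A else 0) A
       = (if A \<in> configs V k then exclusion_generator E f A else 0)"
  using switch_in_configs[OF assms, of _ A k] by (simp add: exclusion_generator_def cong: sum.cong)

text \<open>Extended by zero to the other levels, an eigenfunction still satisfies the eigenvalue
  equation, and \<open>exclusion_poincare\<close> bounds its Rayleigh quotient from below.\<close>

lemma eigenvalue_ge_walk_gap:
  assumes V: "finite V" and E: "edges_on V E" and gap: "walk_gap V (edge_weight E) c" "c \<ge> 0"
    and ev: "exclusion_eigenvalue V E k \<mu>" "\<mu> \<noteq> 0"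
  shows "c \<le> \<mu>"
proof -
  obtain f A0 where A0: "A0 \<in> configs V k" "f A0 \<noteq> 0"
    and f: "\<And>A. A \<in> configs V k \<Longrightarrow> - exclusion_generator E f A = \<mu> * f A"
    using ev(1) by (auto simp: exclusion_eigenvalue_def)
  define F where "F = (\<lambda>A. if A \<in> configs V k then f A else 0)"
  have lap: "laplacian V (edge_weight E) F A = 2 * \<mu> * F A" for A
    using f[of A] unfolding laplacian_eq_generator[OF V E] F_def generator_restrict[OF E] by simp
  \<comment> \<open>Self-adjointness tested against the constant function, which the Laplacian
    kills: a nonzero eigenvalue forces mean zero.\<close>
  have "(\<Sum>A\<in>Pow V. 2 * \<mu> * F A) = (\<Sum>A\<in>Pow V. F A * laplacian V (edge_weight E) (\<lambda>_. 1) A)"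
    using laplacian_symmetric[OF V, of "\<lambda>_. 1" "edge_weight E" F] by (simp add: lap)
  also have "\<dots> = 0" by (simp add: laplacian_def)
  finally have "(\<Sum>A\<in>Pow V. F A) = 0" using ev(2) by (simp flip: sum_distrib_left)
  moreover have "(\<Sum>A\<in>Pow V. F A) = (\<Sum>A\<in>configs V k. F A)"
    using V by (intro sum.mono_neutral_right) (auto simp: F_def configs_def)
  ultimately have "(\<Sum>A\<in>configs V j. F A) = 0" for j
    by (cases "j = k") (auto simp: F_def configs_def intro: sum.neutral)
  then have "2 * c * (\<Sum>A\<in>Pow V. (F A)^2) \<le> (\<Sum>x\<in>V. \<Sum>y\<in>V. edge_weight E x y * swap_energy V F x y)"
    using V gap by (intro exclusion_poincare edge_weight_commute edge_weight_nonneg)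
  also have "\<dots> = (\<Sum>A\<in>Pow V. F A * laplacian V (edge_weight E) F A)"
    by (simp add: sum_mult_laplacian swap_energy_def)
  also have "\<dots> = 2 * \<mu> * (\<Sum>A\<in>Pow V. (F A)^2)"
    by (simp add: lap power2_eq_square sum_distrib_left mult_ac)
  finally have "c * (\<Sum>A\<in>Pow V. (F A)^2) \<le> \<mu> * (\<Sum>A\<in>Pow V. (F A)^2)" by simp
  moreover have "(\<Sum>A\<in>Pow V. (F A)^2) > 0"
    using V A0 by (intro sum_pos2[of _ A0]) (auto simp: F_def configs_def)
  ultimately show ?thesis by simp
qed

section \<open>Eigenvalues of symmetric kernels\<close>

lemma real_quadratic_nonpos_imp_linear_zero:
  fixes a b :: real
  assumes "\<And>t. 2 * t * a + t^2 * b \<le> 0"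
  shows "a = 0"
proof (rule ccontr)
  assume "a \<noteq> 0"
  \<comment> \<open>Small enough that the linear term dominates \<open>t^2 * b\<close>, and of the
    sign that makes it positive.\<close>
  define t where "t = a / (\<bar>b\<bar> + 1)"
  have "\<bar>b\<bar> + 1 \<noteq> 0" by linarith
  then have "a = t * (\<bar>b\<bar> + 1)" by (simp add: t_def)
  then have "2 * t * a + t^2 * b = t^2 * (2 * (\<bar>b\<bar> + 1) + b)"
    by (simp add: power2_eq_square algebra_simps)
  moreover have "t^2 > 0" using \<open>a \<noteq> 0\<close> by (simp add: t_def)
  moreover have "2 * (\<bar>b\<bar> + 1) + b > 0" by simp
  ultimately have "2 * t * a + t^2 * b > 0" by simp
  then show False using assms[of t] by simp
qed

text \<open>The type \<open>'a\<close> may be infinite; vanishing off \<open>S\<close> places the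
  unit sphere in a product of compact sets, where Tychonoff's theorem applies.\<close>

lemma compact_unit_functions:
  fixes S :: "'a set"
  assumes "finite S"
  shows "compact {f :: 'a \<Rightarrow> real. (\<forall>a. a \<notin> S \<longrightarrow> f a = 0) \<and> (\<Sum>a\<in>S. (f a)^2) = 1}"
proof -
  define B where "B = (PiE UNIV (\<lambda>a. if a \<in> S then {-1..1::real} else {0}))"
  have "compactin (product_topology (\<lambda>_. euclidean) UNIV) B"
    unfolding B_def compactin_PiE by auto
  then have "compact B" by (simp add: euclidean_product_topology)
  moreover have "closed {f :: 'a \<Rightarrow> real. (\<Sum>a\<in>S. (f a)^2) = 1}"
    by (intro closed_Collect_eq continuous_intros continuous_on_product_coordinates)
  moreover have "{f :: 'a \<Rightarrow> real. (\<forall>a. a \<notin> S \<longrightarrow> f a = 0) \<and> (\<Sum>a\<in>S. (f a)^2) = 1} = B \<inter> {f. (\<Sum>a\<in>S. (f a)^2) = 1}"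
  proof -
    have "\<bar>f a\<bar> \<le> 1" if "(\<Sum>a\<in>S. (f a)^2) = 1" "a \<in> S" for f :: "'a \<Rightarrow> real" and a
    proof -
      have "(f a)^2 \<le> (\<Sum>a\<in>S. (f a)^2)" using that assms by (intro member_le_sum) auto
      then show ?thesis using that by (simp add: abs_square_le_1)
    qed
    then show ?thesis by (fastforce simp: B_def abs_le_iff split: if_splits)
  qed
  ultimately show ?thesis by (simp add: compact_Int_closed)
qed

text \<open>The Rayleigh quotient attains its maximum on the unit sphere, and a maximiser is an
  eigenvector. The point mass at \<open>a0\<close> has value \<open>m a0 a0\<close>, so the maximum
  is positive.\<close>

lemma symmetric_kernel_eigenvalue:
  fixes m :: "'a \<Rightarrow> 'a \<Rightarrow> real"
  assumes S: "finite S" and sym: "\<And>a b. a \<in> S \<Longrightarrow> b \<in> S \<Longrightarrow> m a b = m b a"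
    and pos: "a0 \<in> S" "m a0 a0 > 0"
  obtains f \<mu> where "\<mu> > 0" "\<exists>a\<in>S. f a \<noteq> 0" "\<And>a. a \<in> S \<Longrightarrow> (\<Sum>b\<in>S. m a b * f b) = \<mu> * f a"
proof -
  define K where "K = {f :: 'a \<Rightarrow> real. (\<forall>a. a \<notin> S \<longrightarrow> f a = 0) \<and> (\<Sum>a\<in>S. (f a)^2) = 1}"
  define Q where "Q f g = (\<Sum>a\<in>S. \<Sum>b\<in>S. m a b * (f a * g b))" for f g
  have "(\<Sum>a\<in>S. (of_bool (a = a0))^2) = (\<Sum>a\<in>S. if a = a0 then 1 else (0::real))"
    by (intro sum.cong) auto
  then have e0: "(\<lambda>a. of_bool (a = a0)) \<in> K" using pos S by (auto simp: K_def)
  have "continuous_on K (\<lambda>f. Q f f)"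
    unfolding Q_def
    by (intro continuous_intros) (rule continuous_on_subset[OF continuous_on_product_coordinates], simp)+
  moreover have "compact K" unfolding K_def by (rule compact_unit_functions[OF S])
  ultimately have "\<exists>f\<in>K. \<forall>g\<in>K. Q g g \<le> Q f f"
    using e0 by (intro continuous_attains_sup) auto
  then obtain f where f: "f \<in> K" and max: "\<And>g. g \<in> K \<Longrightarrow> Q g g \<le> Q f f" by blast
  define \<mu> where "\<mu> = Q f f"
  have "Q (\<lambda>a. of_bool (a = a0)) (\<lambda>a. of_bool (a = a0)) = m a0 a0"
  proof -
    have "m a b * (of_bool (a = a0) * of_bool (b = a0)) = (if b = a0 then if a = a0 then m a b else 0 else 0)" for a b
      by simp
    then show ?thesis unfolding Q_def using S pos by (simp add: sum.delta)
  qed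
  then have \<mu>: "\<mu> > 0" using max[OF e0] pos by (simp add: \<mu>_def)
  have le: "Q g g \<le> \<mu> * (\<Sum>a\<in>S. (g a)^2)" for g
  proof (cases "(\<Sum>a\<in>S. (g a)^2) = 0")
    case True
    then have "\<And>a. a \<in> S \<Longrightarrow> g a = 0" using S by (simp add: sum_nonneg_eq_0_iff)
    then show ?thesis using True by (simp add: Q_def)
  next
    case False
    define s where "s = (\<Sum>a\<in>S. (g a)^2)"
    have s: "s > 0" using False unfolding s_def by (smt (verit) sum_nonneg zero_le_power2)
    define G where "G a = (if a \<in> S then g a / sqrt s else 0)" for a
    have "(\<Sum>a\<in>S. (G a)^2) = 1"
      using s by (simp add: G_def power_divide s_def flip: sum_divide_distrib)
    then have "Q G G \<le> \<mu>" using max[of G] by (simp add: K_def G_def \<mu>_def)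
    moreover have "Q G G = Q g g / s"
    proof -
      have "m a b * (G a * G b) = m a b * (g a * g b) / s" if "a \<in> S" "b \<in> S" for a b
        using s that by (simp add: G_def)
      then show ?thesis by (simp add: Q_def sum_divide_distrib)
    qed
    ultimately show ?thesis using s by (simp add: s_def[symmetric] pos_divide_le_eq)
  qed
  have "(\<Sum>b\<in>S. m a b * f b) = \<mu> * f a" if a: "a \<in> S" for a
  proof -
    \<comment> \<open>Perturbing the maximiser in the direction of the point mass at
      \<open>a\<close> gives stationarity, which is the eigenvalue equation at
      \<open>a\<close>.\<close>
    define h where "h b = (of_bool (b = a) :: real)" for b
    have Qhf: "Q h f = (\<Sum>b\<in>S. m a b * f b)"
    proof -
      have "(\<Sum>b\<in>S. m c b * (h c * f b)) = (if c = a then (\<Sum>b\<in>S. m c b * f b) else 0)" for c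
        by (simp add: h_def)
      then show ?thesis unfolding Q_def using S a by simp
    qed
    have Qfh: "Q f h = Q h f"
      unfolding Q_def by (subst sum.swap) (simp add: sym mult_ac cong: sum.cong)
    have fh: "(\<Sum>b\<in>S. f b * h b) = f a"
      using S a by (simp add: h_def of_bool_def if_distrib cong: if_cong)
    have "2 * t * (Q h f - \<mu> * f a) + t^2 * (Q h h - \<mu> * (\<Sum>b\<in>S. (h b)^2)) \<le> 0" for t
    proof -
      have "Q (\<lambda>b. f b + t * h b) (\<lambda>b. f b + t * h b) = Q f f + t * Q f h + t * Q h f + t^2 * Q h h"
        by (simp add: Q_def algebra_simps sum.distrib sum_distrib_left power2_eq_square)
      moreover have "(\<Sum>b\<in>S. (f b + t * h b)^2) = (\<Sum>b\<in>S. (f b)^2) + 2 * t * (\<Sum>b\<in>S. f b * h b) + t^2 * (\<Sum>b\<in>S. (h b)^2)"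
        by (simp add: power2_sum power_mult_distrib sum.distrib sum_distrib_left mult_ac)
      moreover have "(\<Sum>b\<in>S. (f b)^2) = 1" using f by (simp add: K_def)
      ultimately show ?thesis
        using le[of "\<lambda>b. f b + t * h b"] unfolding fh Qfh by (simp add: \<mu>_def[symmetric] algebra_simps)
    qed
    then show ?thesis using real_quadratic_nonpos_imp_linear_zero Qhf by fastforce
  qed
  moreover have "\<exists>a\<in>S. f a \<noteq> 0"
  proof (rule ccontr)
    assume "\<not> ?thesis"
    then have "(\<Sum>a\<in>S. (f a)^2) = 0" by simp
    then show False using f by (simp add: K_def)
  qed
  ultimately show ?thesis using that \<mu> by blast
qed


section \<open>The spectrum of the exclusion process is finite and has a positive element\<close>

definition exclusion_kernel :: "'v set set \<Rightarrow> 'v set \<Rightarrow> 'v set \<Rightarrow> real" where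
  "exclusion_kernel E A B = (\<Sum>e\<in>E. of_bool (A = B) - of_bool (switch e A = B))"

lemma exclusion_kernel_sum:
  assumes V: "finite V" and E: "edges_on V E" and A: "A \<in> configs V k"
  shows "(\<Sum>B\<in>configs V k. exclusion_kernel E A B * f B) = - exclusion_generator E f A"
proof -
  have delta: "(\<Sum>B\<in>configs V k. of_bool (C = B) * f B) = f C" if "C \<in> configs V k" for C
  proof -
    have "(\<Sum>B\<in>configs V k. of_bool (C = B) * f B) = (\<Sum>B\<in>configs V k. if C = B then f B else 0)"
      by (intro sum.cong) auto
    then show ?thesis using that finite_configs[OF V] by simp
  qed
  have "(\<Sum>B\<in>configs V k. exclusion_kernel E A B * f B)
      = (\<Sum>e\<in>E. (\<Sum>B\<in>configs V k. of_bool (A = B) * f B) - (\<Sum>B\<in>configs V k. of_bool (switch e A = B) * f B))"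
    unfolding exclusion_kernel_def sum_distrib_right
    by (subst sum.swap) (simp add: left_diff_distrib sum_subtractf)
  also have "\<dots> = (\<Sum>e\<in>E. f A - f (switch e A))"
    using A by (intro sum.cong refl) (simp add: delta switch_in_configs[OF E])
  finally show ?thesis by (simp add: exclusion_generator_def sum_subtractf)
qed

lemma exclusion_kernel_commute:
  assumes "edges_on V E"
  shows "exclusion_kernel E A B = exclusion_kernel E B A"
proof -
  have sw: "switch e A = B \<longleftrightarrow> switch e B = A" if "e \<in> E" for e
  proof -
    have "\<exists>x\<in>V. \<exists>y\<in>V. x \<noteq> y \<and> e = {x, y}" using assms that by (simp add: edges_on_def)
    then obtain x y where xy: "x \<noteq> y" "e = {x, y}" by blast
    have "transpose x y ` transpose x y ` C = C" for C by (simp add: image_comp)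
    then show ?thesis unfolding xy(2) switch_pair[OF xy(1)] by metis
  qed
  show ?thesis
    unfolding exclusion_kernel_def by (intro sum.cong refl) (simp add: sw eq_commute[of A B])
qed

lemma exclusion_eigenvalue_iff:
  assumes "finite V" "edges_on V E"
  shows "exclusion_eigenvalue V E k \<mu> \<longleftrightarrow>
    (\<exists>f. (\<exists>A\<in>configs V k. f A \<noteq> 0) \<and>
      (\<forall>A\<in>configs V k. (\<Sum>B\<in>configs V k. exclusion_kernel E A B * f B) = \<mu> * f A))"
  by (simp add: exclusion_eigenvalue_def exclusion_kernel_sum[OF assms])

text \<open>A diagonal entry of the kernel counts the edges whose switch changes the configuration.
  One black and one white ball at the ends of an edge make it positive.\<close>

lemma exists_positive_eigenvalue:
  assumes V: "finite V" and E: "edges_on V E" and k: "1 \<le> k" "k < card V" and ne: "E \<noteq> {}"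
  shows "\<exists>\<mu>>0. exclusion_eigenvalue V E k \<mu>"
proof -
  obtain x y where xy: "x \<in> V" "y \<in> V" "x \<noteq> y" "{x, y} \<in> E" using E ne by (fastforce simp: edges_on_def)
  have "card (V - {x, y}) = card V - 2" using V xy by (simp add: card_Diff_subset)
  then have "k - 1 \<le> card (V - {x, y})" using k by simp
  then obtain W where W: "W \<subseteq> V - {x, y}" "card W = k - 1" by (meson obtain_subset_with_card_n)
  have "finite W" using W V by (meson finite_Diff finite_subset)
  then have A: "insert x W \<in> configs V k" using W xy k by (auto simp: configs_def card_insert_if)
  have moved: "switch {x, y} (insert x W) \<noteq> insert x W"
    using W xy by (auto simp: switch_pair transpose_image_eq)
  have "exclusion_kernel E (insert x W) (insert x W) > 0"
    unfolding exclusion_kernel_def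
    using finite_edges[OF V E] xy moved by (intro sum_pos2[of _ "{x, y}"]) auto
  then obtain f \<mu> where "\<mu> > 0" "\<exists>A\<in>configs V k. f A \<noteq> 0"
    "\<And>A. A \<in> configs V k \<Longrightarrow> (\<Sum>B\<in>configs V k. exclusion_kernel E A B * f B) = \<mu> * f A"
    by (rule symmetric_kernel_eigenvalue[where m = "exclusion_kernel E",
          OF finite_configs[OF V] exclusion_kernel_commute[OF E] A]) (rule that)
  then show ?thesis unfolding exclusion_eigenvalue_iff[OF V E] by blast
qed

text \<open>Normalised eigenfunctions of distinct eigenvalues are orthonormal; sum Bessel's inequality over \<open>S\<close>.\<close>
lemma finite_symmetric_kernel_eigenvalues:
  fixes m :: "'a \<Rightarrow> 'a \<Rightarrow> real"
  assumes S: "finite S" and sym: "\<And>a b. a \<in> S \<Longrightarrow> b \<in> S \<Longrightarrow> m a b = m b a"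
  shows "finite {\<mu>. \<exists>f. (\<exists>a\<in>S. f a \<noteq> 0) \<and> (\<forall>a\<in>S. (\<Sum>b\<in>S. m a b * f b) = \<mu> * f a)}" (is "finite ?M")
proof -
  define M where "M = ?M"
  have "finite M \<and> card M \<le> card S"
  proof (rule finite_if_finite_subsets_card_bdd)
    have ex: "\<exists>f. (\<Sum>a\<in>S. (f a)^2) = 1 \<and> (\<forall>a\<in>S. (\<Sum>b\<in>S. m a b * f b) = \<mu> * f a)" if "\<mu> \<in> M" for \<mu>
    proof -
      have "\<exists>f. (\<exists>a\<in>S. f a \<noteq> 0) \<and> (\<forall>a\<in>S. (\<Sum>b\<in>S. m a b * f b) = \<mu> * f a)"
        using that by (simp only: M_def mem_Collect_eq)
      then obtain f where f: "\<exists>a\<in>S. f a \<noteq> 0" "\<forall>a\<in>S. (\<Sum>b\<in>S. m a b * f b) = \<mu> * f a" by blast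
      define s where "s = (\<Sum>a\<in>S. (f a)^2)"
      have s: "s > 0" unfolding s_def using f(1) S by (auto intro: sum_pos2)
      have "(\<Sum>a\<in>S. (f a / sqrt s)^2) = 1"
        using s by (simp add: power_divide s_def flip: sum_divide_distrib)
      moreover have "(\<Sum>b\<in>S. m a b * (f b / sqrt s)) = \<mu> * (f a / sqrt s)" if "a \<in> S" for a
        using f(2) that by (simp flip: sum_divide_distrib)
      ultimately show ?thesis by (intro exI[of _ "\<lambda>a. f a / sqrt s"]) auto
    qed
    have "\<exists>F. \<forall>\<mu>\<in>M. (\<Sum>a\<in>S. (F \<mu> a)^2) = 1 \<and> (\<forall>a\<in>S. (\<Sum>b\<in>S. m a b * F \<mu> b) = \<mu> * F \<mu> a)"
      by (rule bchoice) (use ex in blast)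
    then obtain F where norm: "\<And>\<mu>. \<mu> \<in> M \<Longrightarrow> (\<Sum>a\<in>S. (F \<mu> a)^2) = 1"
      and eig: "\<And>\<mu> a. \<mu> \<in> M \<Longrightarrow> a \<in> S \<Longrightarrow> (\<Sum>b\<in>S. m a b * F \<mu> b) = \<mu> * F \<mu> a"
      by blast
    have orth: "(\<Sum>a\<in>S. F \<mu> a * F \<nu> a) = 0" if "\<mu> \<in> M" "\<nu> \<in> M" "\<mu> \<noteq> \<nu>" for \<mu> \<nu>
    proof -
      have "\<mu> * (\<Sum>a\<in>S. F \<mu> a * F \<nu> a) = (\<Sum>a\<in>S. (\<Sum>b\<in>S. m a b * F \<mu> b) * F \<nu> a)"
        unfolding sum_distrib_left using eig[OF that(1)] by (intro sum.cong) auto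
      also have "\<dots> = (\<Sum>b\<in>S. (\<Sum>a\<in>S. m b a * F \<nu> a) * F \<mu> b)"
        unfolding sum_distrib_right by (subst sum.swap) (simp add: sym mult_ac cong: sum.cong)
      also have "\<dots> = \<nu> * (\<Sum>a\<in>S. F \<mu> a * F \<nu> a)"
        unfolding sum_distrib_left using eig[OF that(2)] by (intro sum.cong) auto
      finally show ?thesis using that(3) by simp
    qed
    fix G assume G: "G \<subseteq> M" "finite G"
    have bessel: "(\<Sum>\<mu>\<in>G. (F \<mu> a)^2) \<le> 1" if a: "a \<in> S" for a
    proof -
      \<comment> \<open>The projection of the point mass at \<open>a\<close> onto the span of the
        eigenfunctions in \<open>G\<close>. Its squared norm equals its value at \<open>a\<close>,
        the sum to be bounded.\<close>
      define P where "P b = (\<Sum>\<mu>\<in>G. F \<mu> a * F \<mu> b)" for b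
      have "0 \<le> (\<Sum>b\<in>S. (of_bool (b = a) - P b)^2)" by (intro sum_nonneg) simp
      also have "\<dots> = (\<Sum>b\<in>S. (if b = a then 1 - 2 * P b else 0) + (P b)^2)"
        by (intro sum.cong) (auto simp: power2_diff)
      also have "\<dots> = 1 - 2 * P a + (\<Sum>b\<in>S. (P b)^2)" using S a by (simp add: sum.distrib)
      also have "(\<Sum>b\<in>S. (P b)^2) = (\<Sum>\<mu>\<in>G. \<Sum>\<nu>\<in>G. F \<mu> a * F \<nu> a * (\<Sum>b\<in>S. F \<mu> b * F \<nu> b))"
      proof -
        have "(\<Sum>b\<in>S. (P b)^2) = (\<Sum>b\<in>S. \<Sum>\<mu>\<in>G. \<Sum>\<nu>\<in>G. F \<mu> a * F \<nu> a * (F \<mu> b * F \<nu> b))"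
          by (simp add: P_def power2_eq_square sum_product mult_ac)
        also have "\<dots> = (\<Sum>\<mu>\<in>G. \<Sum>\<nu>\<in>G. \<Sum>b\<in>S. F \<mu> a * F \<nu> a * (F \<mu> b * F \<nu> b))"
          by (subst sum.swap) (intro sum.cong refl sum.swap)
        finally show ?thesis by (simp add: sum_distrib_left)
      qed
      also have "\<dots> = (\<Sum>\<mu>\<in>G. \<Sum>\<nu>\<in>G. if \<nu> = \<mu> then F \<mu> a * F \<nu> a else 0)"
      proof (intro sum.cong refl)
        fix \<mu> \<nu> assume "\<mu> \<in> G" "\<nu> \<in> G"
        then show "F \<mu> a * F \<nu> a * (\<Sum>b\<in>S. F \<mu> b * F \<nu> b) = (if \<nu> = \<mu> then F \<mu> a * F \<nu> a else 0)"
          using orth[of \<mu> \<nu>] norm[of \<mu>] G(1) by (auto simp: power2_eq_square subset_iff)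
      qed
      also have "\<dots> = P a" using G(2) by (simp add: P_def)
      finally have "P a \<le> 1" by simp
      then show ?thesis by (simp add: P_def power2_eq_square)
    qed
    have "real (card G) = (\<Sum>\<mu>\<in>G. \<Sum>a\<in>S. (F \<mu> a)^2)" using norm G(1) by (simp add: subset_iff)
    also have "\<dots> = (\<Sum>a\<in>S. \<Sum>\<mu>\<in>G. (F \<mu> a)^2)" by (rule sum.swap)
    also have "\<dots> \<le> (\<Sum>a\<in>S. 1)" by (intro sum_mono bessel)
    finally show "card G \<le> card S" by simp
  qed
  then show ?thesis by (simp add: M_def)
qed

text \<open>\<open>Min\<close> has its meaning only on finite nonempty sets, so both properties of
  the set of nonzero eigenvalues are established before comparing its elements with
  \<open>c\<close>.\<close>

lemma spectral_gap_ge: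
  assumes V: "finite V" and E: "edges_on V E" "E \<noteq> {}" and k: "1 \<le> k" "k < card V"
    and gap: "walk_gap V (edge_weight E) c" "c \<ge> 0"
  shows "spectral_gap V E k \<ge> c"
proof -
  define M where "M = {\<mu>. exclusion_eigenvalue V E k \<mu> \<and> \<mu> \<noteq> 0}"
  have "finite {\<mu>. exclusion_eigenvalue V E k \<mu>}"
    unfolding exclusion_eigenvalue_iff[OF V E(1)]
    by (rule finite_symmetric_kernel_eigenvalues[OF finite_configs[OF V] exclusion_kernel_commute[OF E(1)]])
  then have "finite M" by (rule rev_finite_subset) (auto simp: M_def)
  moreover have "M \<noteq> {}" using exists_positive_eigenvalue[OF V E(1) k E(2)] by (auto simp: M_def)
  moreover have "\<forall>\<mu>\<in>M. c \<le> \<mu>" using eigenvalue_ge_walk_gap[OF V E(1) gap] by (auto simp: M_def)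
  ultimately show ?thesis by (simp add: spectral_gap_def M_def[symmetric] Min_ge_iff)
qed

section \<open>The torus\<close>

lemma finite_torus_verts: "finite (torus_verts d L)"
  by (simp add: torus_verts_def finite_PiE)

lemma torus_step:
  assumes "x \<in> torus_verts d L" "i < d" "a < L"
  shows "x(i := a) \<in> torus_verts d L"
  using assms by (auto simp: torus_verts_def PiE_iff extensional_def)

lemma edges_on_torus:
  assumes "L \<ge> 2"
  shows "edges_on (torus_verts d L) (torus_edges d L)"
  unfolding edges_on_def
proof
  fix e assume "e \<in> torus_edges d L"
  then obtain x i where x: "x \<in> torus_verts d L" "i < d" "e = {x, x(i := (x i + 1) mod L)}"
    by (auto simp: torus_edges_def)
  have lt: "x i < L" using x by (auto simp: torus_verts_def)
  have "(x i + 1) mod L \<noteq> x i"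
  proof (cases "x i + 1 < L")
    case False
    then have "x i + 1 = L" using lt by simp
    then show ?thesis using assms by (auto)
  qed simp
  then have "x \<noteq> x(i := (x i + 1) mod L)" by (metis fun_upd_same)
  moreover have "x(i := (x i + 1) mod L) \<in> torus_verts d L"
    using x assms by (intro torus_step) auto
  ultimately show "\<exists>x\<in>torus_verts d L. \<exists>y\<in>torus_verts d L. x \<noteq> y \<and> e = {x, y}"
    using x by blast
qed

text \<open>Upward steps correspond injectively to ordered pairs of adjacent vertices; the remaining
  pairs contribute nonnegative terms.\<close>

lemma path_form_le_walk_form:
  "path_form d L g \<le> (\<Sum>x\<in>torus_verts d L. \<Sum>y\<in>torus_verts d L. edge_weight (torus_edges d L) x y * (g x - g y)^2)"
proof -
  define V where "V = torus_verts d L"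
  define w where "w = edge_weight (torus_edges d L)"
  define T where "T = {p \<in> {..<d} \<times> V. Suc (snd p (fst p)) < L}"
  define step where "step p = (snd p, (snd p)(fst p := Suc (snd p (fst p))))" for p :: "nat \<times> (nat \<Rightarrow> nat)"
  define q where "q p = w (fst p) (snd p) * (g (fst p) - g (snd p))^2" for p
  have V: "finite V" by (simp add: V_def finite_torus_verts)
  have "path_form d L g = (\<Sum>p\<in>{..<d} \<times> V. if Suc (snd p (fst p)) < L then (g ((snd p)(fst p := Suc (snd p (fst p)))) - g (snd p))^2 else 0)"
    by (simp add: path_form_def V_def sum.cartesian_product case_prod_unfold)
  also have "\<dots> = (\<Sum>p\<in>T. q (step p))"
  proof (rule sum.mono_neutral_cong_right)
    fix p assume p: "p \<in> T"
    define i x where "i = fst p" and "x = snd p"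
    have *: "i < d" "x \<in> V" "Suc (x i) < L" using p by (auto simp: T_def i_def x_def)
    then have "{x, x(i := Suc (x i))} \<in> torus_edges d L"
      unfolding torus_edges_def V_def by (auto intro!: exI[of _ x] exI[of _ i])
    moreover have "x \<noteq> x(i := Suc (x i))" by (metis fun_upd_same n_not_Suc_n)
    ultimately have "w x (x(i := Suc (x i))) = 1" by (simp add: w_def edge_weight_def)
    then show "(if Suc (snd p (fst p)) < L then (g ((snd p)(fst p := Suc (snd p (fst p)))) - g (snd p))^2 else 0) = q (step p)"
      using * by (simp add: q_def step_def i_def x_def power2_commute)
  qed (use V in \<open>auto simp: T_def\<close>)
  also have "\<dots> = (\<Sum>p\<in>step ` T. q p)"
  proof -
    have "inj_on step T"
    proof (rule inj_onI)
      fix p p' assume "step p = step p'"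
      then have eq: "snd p = snd p'" "(snd p)(fst p := Suc (snd p (fst p))) = (snd p')(fst p' := Suc (snd p' (fst p')))"
        by (auto simp: step_def)
      then have "fst p = fst p'" by (metis fun_upd_apply n_not_Suc_n)
      then show "p = p'" using eq(1) by (simp add: prod_eq_iff)
    qed
    then show ?thesis by (simp add: sum.reindex)
  qed
  also have "\<dots> \<le> (\<Sum>p\<in>V \<times> V. q p)"
  proof (rule sum_mono2)
    show "step ` T \<subseteq> V \<times> V"
      by (auto simp: T_def step_def V_def intro!: torus_step)
  qed (use V in \<open>auto simp: q_def w_def edge_weight_nonneg\<close>)
  also have "\<dots> = (\<Sum>x\<in>V. \<Sum>y\<in>V. w x y * (g x - g y)^2)"
    by (simp add: sum.cartesian_product case_prod_unfold q_def)
  finally show ?thesis by (simp add: V_def w_def)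
qed

text \<open>The constant is the inverse of \<open>L^2 / 2\<close> from \<open>grid_poincare\<close>,
  halved by the factor 2 in \<open>walk_gap\<close>.\<close>

lemma torus_walk_gap:
  assumes "L \<ge> 1"
  shows "walk_gap (torus_verts d L) (edge_weight (torus_edges d L)) (1 / real L ^ 2)"
  unfolding walk_gap_def
proof (intro allI impI)
  fix g :: "(nat \<Rightarrow> nat) \<Rightarrow> real"
  assume g: "(\<Sum>x\<in>torus_verts d L. g x) = 0"
  have N: "real L ^ d > 0" using assms by simp
  have "real L ^ d * (\<Sum>x\<in>torus_verts d L. (g x)^2) \<le> real L ^ d * (real L^2 / 2 * path_form d L g)"
    using grid_poincare[of L d g] g by simp
  then have "(\<Sum>x\<in>torus_verts d L. (g x)^2) \<le> real L^2 / 2 * path_form d L g"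
    using N by (simp only: mult_le_cancel_left_pos)
  then have "2 * (1 / real L ^ 2) * (\<Sum>x\<in>torus_verts d L. (g x)^2) \<le> path_form d L g"
    using assms by (simp add: field_simps)
  then show "2 * (1 / real L ^ 2) * (\<Sum>x\<in>torus_verts d L. (g x)^2)
      \<le> (\<Sum>x\<in>torus_verts d L. \<Sum>y\<in>torus_verts d L. edge_weight (torus_edges d L) x y * (g x - g y)^2)"
    using path_form_le_walk_form[of d L g] by linarith
qed

lemma torus_spectral_gap:
  assumes "d \<ge> 1" "L \<ge> 2" "1 \<le> k" "real k \<le> 1 / 2 * real L ^ d"
  shows "spectral_gap (torus_verts d L) (torus_edges d L) k \<ge> 1 / real L ^ 2"
proof (rule spectral_gap_ge[OF finite_torus_verts edges_on_torus[OF assms(2)] _ assms(3) _ torus_walk_gap])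
  define x where "x = (\<lambda>i\<in>{..<d}. 0 :: nat)"
  have "x \<in> torus_verts d L" using assms(2) by (auto simp: x_def torus_verts_def)
  then have "{x, x(0 := (x 0 + 1) mod L)} \<in> torus_edges d L"
    using assms(1) unfolding torus_edges_def by (intro CollectI exI conjI refl) auto
  then show "torus_edges d L \<noteq> {}" by blast
  have card: "card (torus_verts d L) = L ^ d" by (simp add: torus_verts_def card_PiE)
  have "real k < real L ^ d" using assms(3,4) by linarith
  then show "k < card (torus_verts d L)" unfolding card by (simp flip: of_nat_power)
qed (use assms in auto)

text \<open>Converts the bound without a logarithm into the required form:
  \<open>1 / log_dim d\<close> is at most 2, whence the witnesses 1/2 and 2 in the theorem. For
  \<open>d = 1\<close> the convention for the logarithm matters, as \<open>ln 1 = 0\<close>.\<close>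

lemma log_dim_ge:
  assumes "d \<ge> 1"
  shows "log_dim d \<ge> 1 / 2"
proof (cases "d = 1")
  case False
  then have "ln 2 \<le> ln (real d)" using assms by simp
  moreover have "ln (2::real) \<ge> 1 / 2" using ln_le_minus_one[of "1/2::real"] by (simp add: ln_div)
  ultimately show ?thesis using False by (simp add: log_dim_def)
qed (simp add: log_dim_def)

theorem mainTheorem3:
  "(\<exists>c::real. c > 0 \<and>
      (\<forall>d L k :: nat. d \<ge> 1 \<longrightarrow> L \<ge> 2 \<longrightarrow> 1 \<le> k \<longrightarrow> real k \<le> 1 / 2 * real L ^ d \<longrightarrow>
         spectral_gap (torus_verts d L) (torus_edges d L) k \<ge> c / (log_dim d * real L ^ 2))) \<and>
   (\<exists>C::real. C > 0 \<and>
      (\<forall>d L k :: nat. d \<ge> 1 \<longrightarrow> L \<ge> 2 \<longrightarrow> 1 \<le> k \<longrightarrow> real k \<le> 1 / 2 * real L ^ d \<longrightarrow>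
         relaxation_time (torus_verts d L) (torus_edges d L) k \<le> C * (real L ^ 2 * log_dim d)))"
proof (intro conjI)
  have weaken: "(1/2) / (log_dim d * real L ^ 2) \<le> 1 / real L ^ 2" if "d \<ge> 1" "L \<ge> 2" for d L :: nat
    using log_dim_ge[OF that(1)] that(2) by (simp add: divide_simps)
  show "\<exists>c::real. c > 0 \<and>
      (\<forall>d L k :: nat. d \<ge> 1 \<longrightarrow> L \<ge> 2 \<longrightarrow> 1 \<le> k \<longrightarrow> real k \<le> 1 / 2 * real L ^ d \<longrightarrow>
         spectral_gap (torus_verts d L) (torus_edges d L) k \<ge> c / (log_dim d * real L ^ 2))"
    using order_trans[OF weaken torus_spectral_gap] by (intro exI[of _ "1/2"]) simp
  have "relaxation_time (torus_verts d L) (torus_edges d L) k \<le> 2 * (real L ^ 2 * log_dim d)"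
    if "d \<ge> 1" "L \<ge> 2" "1 \<le> k" "real k \<le> 1 / 2 * real L ^ d" for d L k :: nat
  proof -
    have "relaxation_time (torus_verts d L) (torus_edges d L) k \<le> 1 / (1 / real L ^ 2)"
      unfolding relaxation_time_def using torus_spectral_gap[OF that] that(2)
      by (intro divide_left_mono mult_pos_pos) (auto intro: less_le_trans[of _ "1 / real L ^ 2"])
    also have "\<dots> \<le> 2 * (real L ^ 2 * log_dim d)"
      using mult_left_mono[OF log_dim_ge[OF that(1)], of "2 * real L ^ 2"] by simp
    finally show ?thesis .
  qed
  then show "\<exists>C::real. C > 0 \<and>
      (\<forall>d L k :: nat. d \<ge> 1 \<longrightarrow> L \<ge> 2 \<longrightarrow> 1 \<le> k \<longrightarrow> real k \<le> 1 / 2 * real L ^ d \<longrightarrow>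
         relaxation_time (torus_verts d L) (torus_edges d L) k \<le> C * (real L ^ 2 * log_dim d))"
    by (intro exI[of _ 2]) simp
qed

end
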